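(* Let $j\ge 2$ be an integer, let $s<-j+\frac12$, and consider $2\pi$-periodic initial data $u_0$. Then the solution map of the Cauchy problem $$u_t+(-1)^{j+1}\partial_x^{2j+1}u+\tfrac12\partial_x(u^2)=0,\qquad u(x,0)=u_0(x),\qquad x\in[0,2\pi)\ \text{(periodic)},$$ is not $C^3$ at zero. More precisely, for any $T>0$, the solution map $$S_t: u_0\in H^s(0,2\pi)\longmapsto u\in C([0,T];H^s(0,2\pi))$$ is not $C^3$ at zero.
   Context: $H^s(0,2\pi)$ is the Sobolev space of $2\pi$-periodic distributions, where throughout only nonzero frequencies $k\in\mathbb{Z}\setminus\{0\}$ occur (mean-zero functions), with norm $\|f\|_{H^s}=\big(\sum_{k\ne0}\langle k\rangle^{2s}|\mathscr{F}_xf(k)|^2\big)^{1/2}$, $\mathscr{F}_xf(k)=\int_0^{2\pi}e^{-ikx}f(x)\,dx$, $\langle k\rangle=(1+|k|^2)^{1/2}$. The solution map sends the initial datum $u_0$ to the corresponding solution $u$ of the Cauchy problem on $[0,T]$. "Not $C^3$ at zero" means that this map is not three times continuously (Fréchet) differentiable at $u_0=0$. *)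

theory Defs
  imports "HOL-Analysis.Analysis" "HOL-Library.Function_Algebras"
begin

section \<open>Normed spaces on carrier sets and Frechet derivatives\<close>

text \<open>
  The norm of \<open>H\<^sup>s\<close> depends on the real number \<open>s\<close>, so \<open>H\<^sup>s\<close> cannot be an instance of the class
  \<^class>\<open>real_normed_vector\<close>, which the library's \<^const>\<open>has_derivative\<close> and type of bounded linear
  maps require. The textbook definitions are therefore stated for a linear subspace of a real
  vector space with a norm function on it.
\<close>

instantiation "fun" :: (type, real_vector) real_vector
begin

definition "scaleR r f = (\<lambda>x. r *\<^sub>R f x)"

instance
  by standard (auto simp: scaleR_fun_def fun_eq_iff algebra_simps)

end

record 'a nspace =
  carrier :: "'a set"
  nrm :: "'a \<Rightarrow> real"

text \<open>
  Bounded real-linear maps from \<open>X\<close> to \<open>Y\<close> with the operator norm. A map is a total function of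
  which only the values on the carrier of \<open>X\<close> matter.
\<close>

definition blin :: "'a::real_vector nspace \<Rightarrow> 'b::real_vector nspace \<Rightarrow> ('a \<Rightarrow> 'b) nspace" where
  "blin X Y = \<lparr>
     carrier = {L. (\<forall>x\<in>carrier X. L x \<in> carrier Y) \<and>
                   (\<forall>x\<in>carrier X. \<forall>y\<in>carrier X. L (x + y) = L x + L y) \<and>
                   (\<forall>c. \<forall>x\<in>carrier X. L (c *\<^sub>R x) = c *\<^sub>R L x) \<and>
                   (\<exists>K. \<forall>x\<in>carrier X. nrm Y (L x) \<le> K * nrm X x)},
     nrm = (\<lambda>L. Inf {K. 0 \<le> K \<and> (\<forall>x\<in>carrier X. nrm Y (L x) \<le> K * nrm X x)}) \<rparr>"

definition has_frechet_derivative ::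
  "'a::real_vector nspace \<Rightarrow> 'b::real_vector nspace \<Rightarrow> ('a \<Rightarrow> 'b) \<Rightarrow> ('a \<Rightarrow> 'b) \<Rightarrow> 'a \<Rightarrow> bool" where
  "has_frechet_derivative X Y f A u \<longleftrightarrow>
     A \<in> carrier (blin X Y) \<and>
     (\<forall>e>0. \<exists>d>0. \<forall>h\<in>carrier X. nrm X h < d \<longrightarrow>
        nrm Y (f (u + h) - f u - A h) \<le> e * nrm X h)"

text \<open>
  Three times Frechet differentiable in a ball around \<open>u\<close>, with third derivative continuous at \<open>u\<close>.
  A map that is of class \<open>C\<^sup>3\<close> on a neighbourhood of \<open>u\<close> satisfies this, so its negation also denies
  that stronger property.
\<close>

definition C3_at :: "'a::real_vector nspace \<Rightarrow> 'b::real_vector nspace \<Rightarrow> ('a \<Rightarrow> 'b) \<Rightarrow> 'a \<Rightarrow> bool" where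
  "C3_at X Y f u \<longleftrightarrow>
     (\<exists>r>0. \<exists>D1 D2 D3.
        (\<forall>v\<in>carrier X. nrm X (v - u) < r \<longrightarrow>
           has_frechet_derivative X Y f (D1 v) v \<and>
           has_frechet_derivative X (blin X Y) D1 (D2 v) v \<and>
           has_frechet_derivative X (blin X (blin X Y)) D2 (D3 v) v) \<and>
        (\<forall>e>0. \<exists>d>0. \<forall>v\<in>carrier X. nrm X (v - u) < d \<longrightarrow>
           nrm (blin X (blin X (blin X Y))) (D3 v - D3 u) < e))"


section \<open>Periodic Sobolev spaces\<close>

definition fourier :: "(real \<Rightarrow> complex) \<Rightarrow> int \<Rightarrow> complex" where
  "fourier f k = integral {0..2*pi} (\<lambda>x. exp (- (\<i> * of_int k * of_real x)) * f x)"

definition bracket :: "int \<Rightarrow> real" where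
  "bracket k = sqrt (1 + (real_of_int \<bar>k\<bar>)\<^sup>2)"

text \<open>
  A \<open>2\<pi>\<close>-periodic distribution is represented by the family of its Fourier coefficients; a smooth
  function \<open>f\<close> is represented by \<^term>\<open>fourier f\<close>. The coefficient at frequency \<open>0\<close> vanishes.
\<close>

definition Hs :: "real \<Rightarrow> (int \<Rightarrow> complex) nspace" where
  "Hs s = \<lparr>
     carrier = {a. a 0 = 0 \<and>
                   (\<lambda>k. bracket k powr (2 * s) * (cmod (a k))\<^sup>2) summable_on (UNIV - {0})},
     nrm = (\<lambda>a. sqrt (\<Sum>\<^sub>\<infinity>k\<in>UNIV - {0}. bracket k powr (2 * s) * (cmod (a k))\<^sup>2)) \<rparr>"

text \<open>The closed real subspace of real-valued distributions.\<close>

definition real_Hs :: "real \<Rightarrow> (int \<Rightarrow> complex) nspace" where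
  "real_Hs s = Hs s \<lparr> carrier := {a \<in> carrier (Hs s). \<forall>k. a (- k) = cnj (a k)} \<rparr>"

text \<open>The space \<open>C([0,T]; E)\<close>; values outside of \<open>[0,T]\<close> are irrelevant.\<close>

definition C_T :: "real \<Rightarrow> 'a::real_vector nspace \<Rightarrow> (real \<Rightarrow> 'a) nspace" where
  "C_T T E = \<lparr>
     carrier = {F. (\<forall>t\<in>{0..T}. F t \<in> carrier E) \<and>
                   (\<forall>t\<in>{0..T}. ((\<lambda>\<tau>. nrm E (F \<tau> - F t)) \<longlongrightarrow> 0) (at t within {0..T}))},
     nrm = (\<lambda>F. SUP t\<in>{0..T}. nrm E (F t)) \<rparr>"


section \<open>The Cauchy problem\<close>

definition Dx :: "(real \<Rightarrow> complex) \<Rightarrow> real \<Rightarrow> complex" where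
  "Dx f = (\<lambda>x. vector_derivative f (at x))"

definition smooth_periodic :: "(real \<Rightarrow> complex) \<Rightarrow> bool" where
  "smooth_periodic f \<longleftrightarrow>
     (\<forall>x. f (x + 2 * pi) = f x) \<and> (\<forall>n x. (Dx ^^ n) f differentiable (at x))"

definition classical_solution ::
  "nat \<Rightarrow> real \<Rightarrow> (real \<Rightarrow> complex) \<Rightarrow> (real \<Rightarrow> real \<Rightarrow> complex) \<Rightarrow> bool" where
  "classical_solution j T f u \<longleftrightarrow>
     (\<forall>t\<in>{0..T}. smooth_periodic (u t)) \<and>
     (\<forall>n. continuous_on ({0..T} \<times> UNIV) (\<lambda>(t, x). (Dx ^^ n) (u t) x)) \<and>
     (\<forall>t\<in>{0..T}. \<forall>x. \<exists>ut.
        ((\<lambda>\<tau>. u \<tau> x) has_vector_derivative ut) (at t within {0..T}) \<and>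
        ut + (-1) ^ (j + 1) * (Dx ^^ (2 * j + 1)) (u t) x + 1 / 2 * Dx (\<lambda>y. (u t y)\<^sup>2) x = 0) \<and>
     (\<forall>x. u 0 x = f x)"

text \<open>
  \<open>S\<close> is a solution map on the data space \<open>X\<close>. For negative \<open>s\<close> the square of a general element of
  \<open>C([0,T]; H\<^sup>s)\<close> is not defined, so the equation itself is only required for smooth initial data,
  where \<open>S\<close> has to give the classical solution. Every notion of solution for rough data that is
  consistent with the classical one yields such an \<open>S\<close>.
\<close>

definition solution_map ::
  "nat \<Rightarrow> real \<Rightarrow> (int \<Rightarrow> complex) nspace \<Rightarrow> ((int \<Rightarrow> complex) \<Rightarrow> real \<Rightarrow> int \<Rightarrow> complex) \<Rightarrow> bool" where
  "solution_map j T X S \<longleftrightarrow>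
     (\<forall>a\<in>carrier X. S a \<in> carrier (C_T T X) \<and> S a 0 = a) \<and>
     (\<forall>f. smooth_periodic f \<and> fourier f \<in> carrier X \<longrightarrow>
        (\<exists>u. classical_solution j T f u \<and> (\<forall>t\<in>{0..T}. S (fourier f) t = fourier (u t))))"

end

theory Submission
  imports Defs
begin

text \<open>
  Take the data \<open>\<delta> cos(N x)\<close> with small \<open>\<delta>\<close> and put \<open>n = 2j + 1\<close>. Written for the coefficients
  \<open>U(t, k) = exp(-i k\<^sup>n t) \<F>u(t)(k)\<close>, the equation is an infinite system whose quadratic interactions oscillate with the phases
  \<open>k\<^sup>n - m\<^sup>n - (k - m)\<^sup>n\<close>. These are at least \<open>\<bar>k m (k - m)\<bar>\<close> in modulus, so integration by parts in time
  recovers the derivative lost in the nonlinearity and yields an a priori bound \<open>O(\<delta>)\<close> of the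
  classical solution in \<open>\<ell>\<^sup>1\<close> of the frequencies on all of \<open>[0, T]\<close>. The bound needs neither
  uniqueness nor conservation laws, hence also covers complex-valued solutions.

  It justifies Picard iteration: \<open>\<F>u(T)(N)\<close> has the expansion \<open>a \<delta> + b \<delta>\<^sup>3 + O(\<delta>\<^sup>4)\<close>, where the resonance
  \<open>N + N - N\<close> makes \<open>\<bar>b\<bar>\<close> comparable to \<open>T N\<^sup>1\<^sup>-\<^sup>2\<^sup>j\<close>. If the solution map had a third derivative at \<open>0\<close>, then
  \<open>6 b\<close> would be its value at the three arguments \<open>cos(N x)\<close>, so that \<open>\<langle>N\<rangle>\<^sup>s \<bar>b\<bar>\<close> would be bounded by a
  multiple of \<open>\<langle>N\<rangle>\<^sup>3\<^sup>s\<close>. This fails for large \<open>N\<close> when \<open>s < 1/2 - j\<close>.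
\<close>

section \<open>Carrier-based seminormed spaces\<close>

text \<open>The class \<open>C^3\<close> is the natural one: the quadratic interactions of the modes
  N and -N only reach the frequencies 0 and 2 N, -2 N, so the first nonlinear contribution at N is
  cubic. The factor T in b arises because the step from 2 N and -N to N has the phase
  \<open>-\<Psi>\<close> and thereby undoes the phase \<open>\<Psi> = (2 N)^n - 2 N^n\<close> of the
  step from N and N to 2 N. What is integrated is a constant plus an oscillation. The two
  coefficients of size N and one division by \<open>\<Psi>\<close> give the power
  \<open>N^(2 - n)\<close>. The obstacle is that s is negative, so no product estimate holds in
  \<open>H^s\<close>. Hence all analysis is done in l^1 of the frequencies, which is closed under
  convolution; \<open>H^s\<close> enters only through the norm of one cosine and the size of one
  coefficient. The order of the limits keeps the estimates crude: N is fixed while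
  \<open>\<delta>\<close> tends to 0, so thresholds for \<open>\<delta>\<close> and the constant of
  the remainder may depend on N and T in any way. Only b is compared for different N. The phase
  vanishes for m = 0 and m = k. These terms drop out since the values of \<open>S\<close> lie in the
  carrier, whose elements have mean zero.\<close>

definition seminormed :: "'a::real_vector nspace \<Rightarrow> bool" where
  "seminormed X \<longleftrightarrow>
     0 \<in> carrier X \<and> nrm X 0 = 0 \<and>
     (\<forall>x\<in>carrier X. 0 \<le> nrm X x) \<and>
     (\<forall>x\<in>carrier X. \<forall>y\<in>carrier X. x - y \<in> carrier X \<and> nrm X (x - y) \<le> nrm X x + nrm X y)"

lemma seminormedD:
  assumes "seminormed X"
  shows "0 \<in> carrier X" "nrm X 0 = 0" "x \<in> carrier X \<Longrightarrow> 0 \<le> nrm X x"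
    "x \<in> carrier X \<Longrightarrow> y \<in> carrier X \<Longrightarrow> x - y \<in> carrier X"
    "x \<in> carrier X \<Longrightarrow> y \<in> carrier X \<Longrightarrow> nrm X (x - y) \<le> nrm X x + nrm X y"
  using assms unfolding seminormed_def by auto

lemma blin_nrm_bound:
  assumes L: "L \<in> carrier (blin X Y)" and x: "x \<in> carrier X" and X: "seminormed X"
  shows "nrm Y (L x) \<le> nrm (blin X Y) L * nrm X x"
proof -
  define B where "B = {K. 0 \<le> K \<and> (\<forall>x\<in>carrier X. nrm Y (L x) \<le> K * nrm X x)}"
  have nB: "nrm (blin X Y) L = Inf B" by (simp add: blin_def B_def)
  obtain K where K: "\<forall>x\<in>carrier X. nrm Y (L x) \<le> K * nrm X x"
    using L by (auto simp: blin_def)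
  have "nrm Y (L x) \<le> max K 0 * nrm X x" if "x \<in> carrier X" for x
    using K that seminormedD(3)[OF X that] by (meson max.cobounded1 mult_right_mono order_trans)
  then have ne: "max K 0 \<in> B" by (auto simp: B_def)
  show ?thesis
  \<comment> \<open>Where the norm of x vanishes, any bound K gives
    \<open>nrm Y (L x) \<le> 0\<close>; elsewhere the quotient is a lower bound of
    \<open>B\<close>.\<close>
  proof (cases "nrm X x = 0")
    case True
    then show ?thesis using K x by fastforce
  next
    case False
    then have pos: "nrm X x > 0" using seminormedD(3)[OF X x] by auto
    have "nrm Y (L x) / nrm X x \<le> Inf B"
    proof (rule cInf_greatest)
      show "B \<noteq> {}" using ne by blast
      show "nrm Y (L x) / nrm X x \<le> K" if "K \<in> B" for K
        using that pos x by (auto simp: B_def divide_le_eq)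
    qed
    then show ?thesis using pos by (simp add: nB divide_le_eq)
  qed
qed

lemma blin_nrm_le:
  assumes "0 \<le> K" "\<And>x. x \<in> carrier X \<Longrightarrow> nrm Y (L x) \<le> K * nrm X x"
  shows "nrm (blin X Y) L \<le> K"
proof -
  have "Inf {K. 0 \<le> K \<and> (\<forall>x\<in>carrier X. nrm Y (L x) \<le> K * nrm X x)} \<le> K"
    using assms by (intro cInf_lower) (auto intro!: bdd_belowI[of _ 0])
  then show ?thesis by (simp add: blin_def)
qed

lemma blin_nrm_nonneg:
  assumes L: "L \<in> carrier (blin X Y)" and X: "seminormed X"
  shows "0 \<le> nrm (blin X Y) L"
proof -
  define B where "B = {K. 0 \<le> K \<and> (\<forall>x\<in>carrier X. nrm Y (L x) \<le> K * nrm X x)}"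
  obtain K where K: "\<forall>x\<in>carrier X. nrm Y (L x) \<le> K * nrm X x"
    using L by (auto simp: blin_def)
  have "nrm Y (L x) \<le> max K 0 * nrm X x" if "x \<in> carrier X" for x
    using K that seminormedD(3)[OF X that] by (meson max.cobounded1 mult_right_mono order_trans)
  then have "max K 0 \<in> B" by (auto simp: B_def)
  then have "B \<noteq> {}" by blast
  then have "0 \<le> Inf B" by (rule cInf_greatest) (auto simp: B_def)
  then show ?thesis by (simp add: blin_def B_def)
qed

text \<open>The clauses of \<open>seminormed\<close> are inherited by operator spaces, so they hold
  in the nested spaces that contain the values of \<open>D1\<close>, \<open>D2\<close> and
  \<open>D3\<close>.\<close>

lemma seminormed_blin:
  assumes X: "seminormed X" and Y: "seminormed Y"
  shows "seminormed (blin X Y)"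
  unfolding seminormed_def
proof (intro conjI ballI)
  show Z: "0 \<in> carrier (blin X Y)"
    using seminormedD[OF Y] seminormedD(3)[OF X] by (auto simp: blin_def intro!: exI[of _ 0])
  show "nrm (blin X Y) 0 = 0"
    using blin_nrm_le[of 0 X Y 0] blin_nrm_nonneg[OF Z X] seminormedD(2)[OF Y] by auto
  show "0 \<le> nrm (blin X Y) L" if "L \<in> carrier (blin X Y)" for L
    using blin_nrm_nonneg[OF that X] .
  fix L M assume L: "L \<in> carrier (blin X Y)" and M: "M \<in> carrier (blin X Y)"
  have b: "nrm Y ((L - M) x) \<le> (nrm (blin X Y) L + nrm (blin X Y) M) * nrm X x"
    if x: "x \<in> carrier X" for x
  proof -
    have "nrm Y (L x - M x) \<le> nrm Y (L x) + nrm Y (M x)"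
      using L M x by (intro seminormedD(5)[OF Y]) (auto simp: blin_def)
    also have "\<dots> \<le> nrm (blin X Y) L * nrm X x + nrm (blin X Y) M * nrm X x"
      by (intro add_mono blin_nrm_bound L M x X)
    finally show ?thesis by (simp add: algebra_simps)
  qed
  show "nrm (blin X Y) (L - M) \<le> nrm (blin X Y) L + nrm (blin X Y) M"
    using blin_nrm_nonneg[OF L X] blin_nrm_nonneg[OF M X] b by (intro blin_nrm_le) auto
  have "(L - M) x \<in> carrier Y" if "x \<in> carrier X" for x
    using L M that seminormedD(4)[OF Y] by (auto simp: blin_def)
  moreover have "(L - M) (x + y) = (L - M) x + (L - M) y" if "x \<in> carrier X" "y \<in> carrier X" for x y
    using L M that by (auto simp: blin_def)
  moreover have "(L - M) (c *\<^sub>R x) = c *\<^sub>R (L - M) x" if "x \<in> carrier X" for c x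
    using L M that by (auto simp: blin_def algebra_simps)
  ultimately show "L - M \<in> carrier (blin X Y)"
    using b unfolding blin_def by (simp add: fun_diff_def) blast
qed

text \<open>Continuity on a compact interval. Without boundedness the supremum in \<open>C_T\<close>
  would be an unspecified real instead of an upper bound.\<close>

lemma C_T_nrm_bdd:
  assumes E: "seminormed E" and F: "F \<in> carrier (C_T T E)"
  shows "bdd_above ((\<lambda>t. nrm E (F t)) ` {0..T})"
proof -
  have mem: "F t \<in> carrier E" if "t \<in> {0..T}" for t using F that by (auto simp: C_T_def)
  have lim: "((\<lambda>\<tau>. nrm E (F \<tau> - F t)) \<longlongrightarrow> 0) (at t within {0..T})" if "t \<in> {0..T}" for t
    using F that by (auto simp: C_T_def)
  have neg: "nrm E (0 - y) \<le> nrm E y" if "y \<in> carrier E" for y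
    using seminormedD(5)[OF E seminormedD(1)[OF E] that] seminormedD(2)[OF E] by simp
  \<comment> \<open>The reverse triangle inequality has to come from the difference clause alone,
    with \<open>0 - y\<close> in the role of the negative.\<close>
  have dist: "\<bar>nrm E x - nrm E y\<bar> \<le> nrm E (x - y)" if x: "x \<in> carrier E" and y: "y \<in> carrier E" for x y
  proof -
    have m: "0 - y \<in> carrier E" "0 - x \<in> carrier E" "x - y \<in> carrier E" "y - x \<in> carrier E"
      using seminormedD(1,4)[OF E] x y by blast+
    have "nrm E ((x - y) - (0 - y)) \<le> nrm E (x - y) + nrm E (0 - y)"
      by (rule seminormedD(5)[OF E]) (use m in auto)
    moreover have "nrm E ((y - x) - (0 - x)) \<le> nrm E (y - x) + nrm E (0 - x)"
      by (rule seminormedD(5)[OF E]) (use m in auto)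
    moreover have "nrm E (0 - (x - y)) \<le> nrm E (x - y)" using neg[OF m(3)] .
    ultimately show ?thesis using neg[OF x] neg[OF y] by simp
  qed
  have "continuous_on {0..T} (\<lambda>t. nrm E (F t))"
    unfolding continuous_on_def
  proof
    fix t assume t: "t \<in> {0..T}"
    have "((\<lambda>\<tau>. nrm E (F \<tau>) - nrm E (F t)) \<longlongrightarrow> 0) (at t within {0..T})"
      by (rule Lim_null_comparison[OF _ lim[OF t]])
         (use dist mem t in \<open>auto simp: eventually_at_filter\<close>)
    then show "((\<lambda>t. nrm E (F t)) \<longlongrightarrow> nrm E (F t)) (at t within {0..T})"
      using Lim_null by blast
  qed
  then show ?thesis
    by (intro bounded_imp_bdd_above compact_imp_bounded compact_continuous_image) auto
qed

lemma C_T_nrm_bound: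
  assumes E: "seminormed E" and F: "F \<in> carrier (C_T T E)" and t: "t \<in> {0..T}"
  shows "nrm E (F t) \<le> nrm (C_T T E) F"
  using cSUP_upper[OF t C_T_nrm_bdd[OF E F]] by (simp add: C_T_def)

lemma seminormed_C_T:
  assumes E: "seminormed E" and T: "0 \<le> T"
  shows "seminormed (C_T T E)"
  unfolding seminormed_def
proof (intro conjI ballI)
  show "0 \<in> carrier (C_T T E)" "nrm (C_T T E) 0 = 0"
    using seminormedD(1,2)[OF E] T by (auto simp: C_T_def)
  show "0 \<le> nrm (C_T T E) F" if F: "F \<in> carrier (C_T T E)" for F
  proof -
    have "0 \<le> nrm E (F 0)" using F T seminormedD(3)[OF E] by (auto simp: C_T_def)
    also have "\<dots> \<le> nrm (C_T T E) F" using C_T_nrm_bound[OF E F] T by auto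
    finally show ?thesis .
  qed
  fix F G assume F: "F \<in> carrier (C_T T E)" and G: "G \<in> carrier (C_T T E)"
  have m: "F t \<in> carrier E" "G t \<in> carrier E" if "t \<in> {0..T}" for t
    using F G that by (auto simp: C_T_def)
  have "nrm E (F t - G t) \<le> nrm (C_T T E) F + nrm (C_T T E) G" if t: "t \<in> {0..T}" for t
    using seminormedD(5)[OF E m[OF t]] C_T_nrm_bound[OF E F t] C_T_nrm_bound[OF E G t] by simp
  then have "(SUP t\<in>{0..T}. nrm E ((F - G) t)) \<le> nrm (C_T T E) F + nrm (C_T T E) G"
    using T by (intro cSUP_least) auto
  then show "nrm (C_T T E) (F - G) \<le> nrm (C_T T E) F + nrm (C_T T E) G"
    by (simp add: C_T_def)
  have "((\<lambda>\<tau>. nrm E ((F \<tau> - G \<tau>) - (F t - G t))) \<longlongrightarrow> 0) (at t within {0..T})"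
    if t: "t \<in> {0..T}" for t
  proof (rule Lim_null_comparison)
    have "((\<lambda>\<tau>. nrm E (F \<tau> - F t) + nrm E (G \<tau> - G t)) \<longlongrightarrow> 0 + 0) (at t within {0..T})"
      using F G t by (intro tendsto_add) (auto simp: C_T_def)
    then show "((\<lambda>\<tau>. nrm E (F \<tau> - F t) + nrm E (G \<tau> - G t)) \<longlongrightarrow> 0) (at t within {0..T})"
      by simp
    have "norm (nrm E ((F \<tau> - G \<tau>) - (F t - G t))) \<le> nrm E (F \<tau> - F t) + nrm E (G \<tau> - G t)"
      if \<tau>: "\<tau> \<in> {0..T}" for \<tau>
    proof -
      have "F \<tau> - F t \<in> carrier E" "G \<tau> - G t \<in> carrier E"
        using seminormedD(4)[OF E] m \<tau> t by blast+
      then have "nrm E ((F \<tau> - F t) - (G \<tau> - G t)) \<le> nrm E (F \<tau> - F t) + nrm E (G \<tau> - G t)"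
        "0 \<le> nrm E ((F \<tau> - F t) - (G \<tau> - G t))"
        using seminormedD(3-5)[OF E] by blast+
      moreover have "(F \<tau> - F t) - (G \<tau> - G t) = (F \<tau> - G \<tau>) - (F t - G t)" by simp
      ultimately show ?thesis by simp
    qed
    then show "\<forall>\<^sub>F \<tau> in at t within {0..T}.
       norm (nrm E ((F \<tau> - G \<tau>) - (F t - G t))) \<le> nrm E (F \<tau> - F t) + nrm E (G \<tau> - G t)"
      by (auto simp: eventually_at_filter)
  qed
  then show "F - G \<in> carrier (C_T T E)"
    using seminormedD(4)[OF E] m by (auto simp: C_T_def)
qed

section \<open>Sobolev norms through weighted finite sums of squares\<close>

lemma powr_double: "(x powr s)\<^sup>2 = x powr (2 * s)" for x s :: real
  by (simp add: power2_eq_square flip: powr_add)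

text \<open>Finite parts written as \<open>L2_set\<close> make the finite Minkowski inequality
  available for the weighted norm.\<close>

lemma Hs_sq_sum_bound:
  assumes a: "a \<in> carrier (Hs s)" and F: "finite F" "0 \<notin> F"
  shows "L2_set (\<lambda>k. bracket k powr s * cmod (a k)) F \<le> nrm (Hs s) a"
proof -
  have sm: "(\<lambda>k. bracket k powr (2 * s) * (cmod (a k))\<^sup>2) summable_on (UNIV - {0})"
    using a by (simp add: Hs_def)
  have "(\<Sum>k\<in>F. (bracket k powr s * cmod (a k))\<^sup>2)
        = (\<Sum>k\<in>F. bracket k powr (2 * s) * (cmod (a k))\<^sup>2)"
    by (intro sum.cong) (auto simp: power_mult_distrib powr_double)
  also have "\<dots> \<le> (\<Sum>\<^sub>\<infinity>k\<in>UNIV - {0}. bracket k powr (2 * s) * (cmod (a k))\<^sup>2)"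
    using F by (intro finite_sum_le_infsum sm) auto
  finally show ?thesis by (simp add: L2_set_def Hs_def)
qed

lemma Hs_coeff_bound:
  assumes a: "a \<in> carrier (Hs s)" and k: "k \<noteq> 0"
  shows "bracket k powr s * cmod (a k) \<le> nrm (Hs s) a"
  using Hs_sq_sum_bound[OF a, of "{k}"] k by (simp add: L2_set_def)

lemma Hs_nrm_nonneg: "0 \<le> nrm (Hs s) a"
  by (auto simp: Hs_def intro!: infsum_nonneg)

lemma seminormed_Hs: "seminormed (Hs s)"
  unfolding seminormed_def
proof (intro conjI ballI)
  show "0 \<in> carrier (Hs s)" "nrm (Hs s) 0 = 0" by (auto simp: Hs_def)
  show "0 \<le> nrm (Hs s) a" for a by (rule Hs_nrm_nonneg)
  fix a b assume a: "a \<in> carrier (Hs s)" and b: "b \<in> carrier (Hs s)"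
  define N where "N = nrm (Hs s) a + nrm (Hs s) b"
  have N: "0 \<le> N" using Hs_nrm_nonneg by (simp add: N_def)
  define f where "f k = bracket k powr (2 * s) * (cmod (a k - b k))\<^sup>2" for k
  have fin: "sum f F \<le> N\<^sup>2" if F: "finite F" "F \<subseteq> UNIV - {0}" for F
  proof -
    have "L2_set (\<lambda>k. bracket k powr s * cmod (a k - b k)) F
          \<le> L2_set (\<lambda>k. bracket k powr s * cmod (a k) + bracket k powr s * cmod (b k)) F"
      by (intro L2_set_mono)
         (auto simp: distrib_left[symmetric] intro!: mult_left_mono norm_triangle_ineq4)
    also have "\<dots> \<le> L2_set (\<lambda>k. bracket k powr s * cmod (a k)) F
                  + L2_set (\<lambda>k. bracket k powr s * cmod (b k)) F"
      by (rule L2_set_triangle_ineq)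
    also have "\<dots> \<le> N" unfolding N_def using F
      by (intro add_mono Hs_sq_sum_bound a b) auto
    finally have "(L2_set (\<lambda>k. bracket k powr s * cmod (a k - b k)) F)\<^sup>2 \<le> N\<^sup>2"
      by (intro power_mono) auto
    also have "(L2_set (\<lambda>k. bracket k powr s * cmod (a k - b k)) F)\<^sup>2
        = (\<Sum>k\<in>F. (bracket k powr s * cmod (a k - b k))\<^sup>2)"
      by (simp add: L2_set_def sum_nonneg)
    also have "\<dots> = sum f F"
      by (intro sum.cong) (auto simp: f_def power_mult_distrib powr_double)
    finally show ?thesis .
  qed
  have sm: "f summable_on (UNIV - {0})"
    using fin by (intro nonneg_bdd_above_summable_on bdd_aboveI[of _ "N\<^sup>2"]) (auto simp: f_def)
  then show "a - b \<in> carrier (Hs s)" using a b by (auto simp: Hs_def f_def[abs_def])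
  have "infsum f (UNIV - {0}) \<le> N\<^sup>2" using sm fin by (rule infsum_le_finite_sums)
  then have "sqrt (infsum f (UNIV - {0})) \<le> N" using N by (simp add: real_le_lsqrt)
  then show "nrm (Hs s) (a - b) \<le> nrm (Hs s) a + nrm (Hs s) b"
    by (simp add: Hs_def f_def[abs_def] N_def)
qed

lemma seminormed_real_Hs: "seminormed (real_Hs s)"
  using seminormed_Hs[of s] unfolding seminormed_def real_Hs_def by auto

text \<open>Restriction to the line through \<open>\<phi>\<close> and a bounded functional
  \<open>P\<close> turn a derivative on carriers into an ordinary one of a complex-valued function
  of a real variable. The radius r is there because derivatives are known to lie in their operator
  spaces only near the base point.\<close>

lemma frechet_imp_vector_derivative:
  fixes P :: "'b::real_vector \<Rightarrow> complex"
  assumes fd: "has_frechet_derivative X Z f A (\<delta> *\<^sub>R \<phi>)"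
    and \<phi>: "\<And>c. c *\<^sub>R \<phi> \<in> carrier X" "\<And>c. nrm X (c *\<^sub>R \<phi>) = \<bar>c\<bar> * q"
    and Z: "seminormed Z"
    and f: "\<And>\<eta>. \<bar>\<eta> - \<delta>\<bar> < r \<Longrightarrow> f (\<eta> *\<^sub>R \<phi>) \<in> carrier Z" and r: "r > 0"
    and P: "linear P" "\<And>z. z \<in> carrier Z \<Longrightarrow> cmod (P z) \<le> C * nrm Z z"
  shows "((\<lambda>\<eta>. P (f (\<eta> *\<^sub>R \<phi>))) has_vector_derivative P (A \<phi>)) (at \<delta>)"
  unfolding has_vector_derivative_def has_derivative_at_alt
proof (intro conjI allI impI)
  show "bounded_linear (\<lambda>x. x *\<^sub>R P (A \<phi>))" by (rule bounded_linear_scaleR_left)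
  fix e :: real assume e: "0 < e"
  have A: "A (c *\<^sub>R \<phi>) = c *\<^sub>R A \<phi>" "A (c *\<^sub>R \<phi>) \<in> carrier Z" for c
    using fd \<phi>(1)[of 1] \<phi>(1)[of c] by (auto simp: has_frechet_derivative_def blin_def)
  \<comment> \<open>The summand 1 keeps the divisor positive even if \<open>C\<close> or
    \<open>q\<close> is 0.\<close>
  define C' where "C' = \<bar>C\<bar> * \<bar>q\<bar> + 1"
  have C': "C' > 0" unfolding C'_def by (simp add: add_nonneg_pos)
  from fd e C' obtain d where d: "d > 0"
    and *: "\<And>h. h \<in> carrier X \<Longrightarrow> nrm X h < d \<Longrightarrow>
        nrm Z (f (\<delta> *\<^sub>R \<phi> + h) - f (\<delta> *\<^sub>R \<phi>) - A h) \<le> e / C' * nrm X h"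
    unfolding has_frechet_derivative_def by (blast dest: spec[of _ "e / C'"] intro: divide_pos_pos)
  have "cmod (P (f (\<eta> *\<^sub>R \<phi>)) - P (f (\<delta> *\<^sub>R \<phi>)) - (\<eta> - \<delta>) *\<^sub>R P (A \<phi>)) \<le> e * \<bar>\<eta> - \<delta>\<bar>"
    if \<eta>: "\<bar>\<eta> - \<delta>\<bar> < min r (d / (\<bar>q\<bar> + 1))" for \<eta>
  proof -
    define h where "h = (\<eta> - \<delta>) *\<^sub>R \<phi>"
    have h: "h \<in> carrier X" "\<delta> *\<^sub>R \<phi> + h = \<eta> *\<^sub>R \<phi>" using \<phi>(1) by (simp_all only: h_def) (simp add: algebra_simps)
    have "\<bar>\<eta> - \<delta>\<bar> * q \<le> \<bar>\<eta> - \<delta>\<bar> * (\<bar>q\<bar> + 1)" by (intro mult_left_mono) auto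
    also have "\<dots> < d" using \<eta> by (simp add: pos_less_divide_eq)
    finally have nh: "nrm X h < d" by (simp add: h_def \<phi>(2))
    define z where "z = f (\<eta> *\<^sub>R \<phi>) - f (\<delta> *\<^sub>R \<phi>) - A h"
    have zc: "z \<in> carrier Z" unfolding z_def h_def using A f \<eta> r by (intro seminormedD(4)[OF Z]) auto
    have nz: "nrm Z z \<le> e / C' * (\<bar>\<eta> - \<delta>\<bar> * q)"
      using *[OF h(1) nh] unfolding h(2) z_def by (simp add: h_def \<phi>(2))
    have "P (f (\<eta> *\<^sub>R \<phi>)) - P (f (\<delta> *\<^sub>R \<phi>)) - (\<eta> - \<delta>) *\<^sub>R P (A \<phi>) = P z"
      using P(1) by (simp add: z_def h_def A(1) linear_diff linear_scale)
    also have "cmod (P z) \<le> C * nrm Z z" by (rule P(2)[OF zc])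
    also have "\<dots> \<le> \<bar>C\<bar> * nrm Z z" using seminormedD(3)[OF Z zc] by (intro mult_right_mono) auto
    also have "\<dots> \<le> \<bar>C\<bar> * (e / C' * (\<bar>\<eta> - \<delta>\<bar> * \<bar>q\<bar>))"
      using nz e C' by (intro mult_left_mono order_trans[OF nz]) auto
    also have "\<dots> = (e * \<bar>\<eta> - \<delta>\<bar>) * ((C' - 1) / C')" by (simp add: C'_def)
    also have "\<dots> \<le> (e * \<bar>\<eta> - \<delta>\<bar>) * 1" using e C' by (intro mult_left_mono) auto
    finally show ?thesis by simp
  qed
  then show "\<exists>d>0. \<forall>y. norm (y - \<delta>) < d \<longrightarrow>
      norm (P (f (y *\<^sub>R \<phi>)) - P (f (\<delta> *\<^sub>R \<phi>)) - (y - \<delta>) *\<^sub>R P (A \<phi>)) \<le> e * norm (y - \<delta>)"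
    using d r by (intro exI[of _ "min r (d / (\<bar>q\<bar> + 1))"]) auto
qed

section \<open>Fourier series\<close>

text \<open>The sign is that of the transform, so \<open>chr (- k)\<close> is the character of
  frequency k. The same factor later describes oscillation in time.\<close>

abbreviation chr :: "int \<Rightarrow> real \<Rightarrow> complex" where
  "chr k x \<equiv> exp (- (\<i> * of_int k * of_real x))"

lemma cmod_chr [simp]: "cmod (chr k x) = 1"
  by (simp add: norm_exp_eq_Re)

lemma chr_2pi [simp]: "chr k (2 * pi) = 1"
proof -
  have "- (\<i> * of_int k * of_real (2 * pi)) = of_int (2 * (- k)) * complex_of_real pi * \<i>" by simp
  then show ?thesis by (subst exp_eq_1) (auto intro!: exI[of _ "- k"])
qed

lemma has_vector_derivative_exp_affine:
  fixes b c :: complex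
  shows "((\<lambda>x. exp (c * of_real x + b)) has_vector_derivative c * exp (c * of_real x + b)) (at x within A)"
  by (rule has_vector_derivative_real_field[of "\<lambda>z. exp (c * z + b)"]) (auto intro!: derivative_eq_intros)

lemma has_vector_derivative_quotient_limit:
  fixes f :: "real \<Rightarrow> complex"
  assumes "(f has_vector_derivative d) (at y)"
  shows "((\<lambda>z. (f z - f y) / of_real (z - y)) \<longlongrightarrow> d) (at y)"
proof -
  have "((\<lambda>z. norm (f z - f y - (z - y) *\<^sub>R d) / norm (z - y)) \<longlongrightarrow> 0) (at y)"
    using assms by (simp add: has_vector_derivative_def has_derivative_iff_norm)
  moreover have "norm (f z - f y - (z - y) *\<^sub>R d) / norm (z - y) = norm ((f z - f y) / of_real (z - y) - d)"
    if "z \<noteq> y" for z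
  proof -
    have "f z - f y - (z - y) *\<^sub>R d = of_real (z - y) * ((f z - f y) / of_real (z - y) - d)"
      unfolding right_diff_distrib using that by (simp add: scaleR_conv_of_real del: of_real_diff)
    then have "norm (f z - f y - (z - y) *\<^sub>R d) = norm (z - y) * norm ((f z - f y) / of_real (z - y) - d)"
      by (simp only: norm_mult norm_of_real real_norm_def)
    then show ?thesis using that by simp
  qed
  then have "\<forall>\<^sub>F z in at y. norm (f z - f y - (z - y) *\<^sub>R d) / norm (z - y) = norm ((f z - f y) / of_real (z - y) - d)"
    by (simp add: eventually_at_filter)
  ultimately have "((\<lambda>z. norm ((f z - f y) / of_real (z - y) - d)) \<longlongrightarrow> 0) (at y)"
    by (rule Lim_transform_eventually)
  then show ?thesis by (subst Lim_null) (rule tendsto_norm_zero_cancel)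
qed

lemma has_vector_derivative_chr:
  "(chr k has_vector_derivative - (\<i> * of_int k) * chr k x) (at x within A)"
  using has_vector_derivative_exp_affine[of "- (\<i> * of_int k)" 0] by simp

lemma fourier_integrable:
  assumes "continuous_on {0..2*pi} f"
  shows "(\<lambda>x. chr k x * f x) integrable_on {0..2*pi}"
  by (intro integrable_continuous_real continuous_intros assms)

lemma fourier_norm_le:
  assumes "continuous_on {0..2*pi} f" "\<And>x. x \<in> {0..2*pi} \<Longrightarrow> cmod (f x) \<le> B"
  shows "cmod (fourier f k) \<le> 2 * pi * B"
proof -
  have "cmod (fourier f k) \<le> B * (2 * pi - 0)"
    unfolding fourier_def
    by (rule integral_bound) (use assms in \<open>auto simp: norm_mult intro!: continuous_intros\<close>)
  then show ?thesis by (simp add: mult_ac)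
qed

lemma fourier_diff:
  assumes "continuous_on {0..2*pi} f" "continuous_on {0..2*pi} g"
  shows "fourier (\<lambda>x. f x - g x) k = fourier f k - fourier g k"
  unfolding fourier_def right_diff_distrib
  by (intro integral_diff fourier_integrable assms)

lemma fourier_add:
  assumes "continuous_on {0..2*pi} f" "continuous_on {0..2*pi} g"
  shows "fourier (\<lambda>x. f x + g x) k = fourier f k + fourier g k"
  unfolding fourier_def distrib_left
  by (intro integral_add fourier_integrable assms)

lemma fourier_derivative:
  assumes p: "\<And>x. x \<in> {0..2*pi} \<Longrightarrow> (p has_vector_derivative p' x) (at x within {0..2*pi})"
    and p': "continuous_on {0..2*pi} p'"
  shows "fourier p' k = \<i> * of_int k * fourier p k + (p (2 * pi) - p 0)"
proof -
  have cp: "continuous_on {0..2*pi} p"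
    using p by (meson has_vector_derivative_continuous continuous_on_eq_continuous_within)
  have "((\<lambda>x. chr k x * p' x + (- (\<i> * of_int k) * chr k x) * p x) has_integral
        (chr k (2 * pi) * p (2 * pi) - chr k 0 * p 0)) {0..2*pi}"
    by (intro fundamental_theorem_of_calculus has_vector_derivative_mult has_vector_derivative_chr p) auto
  then have "((\<lambda>x. chr k x * p' x + (- (\<i> * of_int k) * chr k x) * p x) has_integral
        (p (2 * pi) - p 0)) {0..2*pi}"
    unfolding chr_2pi by simp
  then have 1: "integral {0..2*pi} (\<lambda>x. chr k x * p' x + (- (\<i> * of_int k)) * (chr k x * p x)) = p (2 * pi) - p 0"
    by (simp only: integral_unique mult.assoc)
  have 2: "integral {0..2*pi} (\<lambda>x. chr k x * p' x + (- (\<i> * of_int k)) * (chr k x * p x))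
    = fourier p' k + (- (\<i> * of_int k)) * fourier p k"
  proof -
    have "(\<lambda>x. c * (chr k x * p x)) integrable_on {0..2*pi}" for c
      by (intro integrable_continuous_real continuous_intros cp)
    then show ?thesis
      unfolding fourier_def by (simp only: integral_add fourier_integrable[OF p'] integral_mult_right)
  qed
  have "p (2 * pi) - p 0 = fourier p' k + (- (\<i> * of_int k)) * fourier p k"
    using trans[OF sym[OF 1] 2] .
  then show ?thesis by simp
qed

text \<open>A polynomial p close to g has coefficients of order 1 / k by integration by parts. As p
  is not periodic, the jump \<open>p (2 * pi) - p 0\<close> remains, but it is a fixed
  constant.\<close>

lemma riemann_lebesgue:
  assumes g: "continuous_on {0..2*pi} g" and e: "e > 0"
  shows "\<exists>K>0. \<forall>k. real_of_int \<bar>k\<bar> > K \<longrightarrow> cmod (fourier g k) < e"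
proof -
  \<comment> \<open>An error d in the function changes a coefficient by at most
    \<open>2 * pi * d\<close>, which is half of e.\<close>
  define d where "d = e / (4 * pi)"
  have d: "d > 0" using e by (simp add: d_def)
  obtain p where p: "polynomial_function p" and gp: "\<And>x. x \<in> {0..2*pi} \<Longrightarrow> cmod (g x - p x) < d"
    using Stone_Weierstrass_polynomial_function[OF compact_Icc g d] by blast
  obtain p' where p': "polynomial_function p'" "\<And>x. (p has_vector_derivative p' x) (at x)"
    using has_vector_derivative_polynomial_function[OF p] by blast
  have cont: "continuous_on A p" "continuous_on A p'" for A
    using p p' by (simp_all add: continuous_on_polymonial_function)
  have "bounded (p' ` {0..2*pi})"
    by (intro compact_imp_bounded compact_continuous_image cont) auto
  then obtain B where B: "\<And>x. x \<in> {0..2*pi} \<Longrightarrow> cmod (p' x) \<le> B"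
    unfolding bounded_iff ball_simps by blast
  define C where "C = 2 * pi * B + cmod (p (2 * pi) - p 0)"
  have B0: "0 \<le> B" using order_trans[OF norm_ge_zero B[of 0]] by simp
  then have C: "0 \<le> C" by (simp add: C_def)
  define K where "K = 2 * C / e + 1"
  have K: "K > 0" using C e by (simp add: K_def add_nonneg_pos)
  have "cmod (fourier g k) < e" if k: "real_of_int \<bar>k\<bar> > K" for k
  proof -
    have "\<i> * of_int k * fourier p k = fourier p' k - (p (2 * pi) - p 0)"
      using fourier_derivative[of p p' k] p'(2) cont by (simp add: has_vector_derivative_at_within)
    then have "cmod (\<i> * of_int k * fourier p k) \<le> C"
      using norm_triangle_ineq4[of "fourier p' k" "p (2 * pi) - p 0"] fourier_norm_le[OF cont(2) B, of k]
      by (simp add: C_def)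
    then have "real_of_int \<bar>k\<bar> * cmod (fourier p k) \<le> C" by (simp add: norm_mult)
    then have "cmod (fourier p k) \<le> C / real_of_int \<bar>k\<bar>"
      using k K by (simp add: le_divide_eq mult.commute)
    also have "\<dots> < e / 2"
    proof -
      have "2 * C / e < real_of_int \<bar>k\<bar>" using k by (simp add: K_def)
      then show ?thesis using e k K by (simp add: field_simps)
    qed
    finally have 1: "cmod (fourier p k) < e / 2" .
    have "cmod (fourier g k) = cmod (fourier (\<lambda>x. g x - p x) k + fourier p k)"
      by (simp add: fourier_diff g cont)
    moreover have "cmod (fourier (\<lambda>x. g x - p x) k) \<le> 2 * pi * d"
      by (intro fourier_norm_le continuous_intros g cont less_imp_le gp)
    moreover have "2 * pi * d = e / 2" by (simp add: d_def)
    ultimately show ?thesis using 1 norm_triangle_ineq[of "fourier (\<lambda>x. g x - p x) k" "fourier p k"] by linarith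
  qed
  then show ?thesis using K by blast
qed

lemma fourier_const: "fourier (\<lambda>x. c) k = (if k = 0 then of_real (2 * pi) * c else 0)"
proof (cases "k = 0")
  case True then show ?thesis by (simp add: fourier_def scaleR_conv_of_real)
next
  case False
  have "fourier (\<lambda>x. 0) k = \<i> * of_int k * fourier (\<lambda>x. c) k + (c - c)"
    by (rule fourier_derivative) auto
  moreover have "fourier (\<lambda>x. 0) k = 0" by (simp add: fourier_def)
  ultimately show ?thesis using False by simp
qed

lemma fourier_chr_mult: "fourier (\<lambda>x. chr m x * f x) k = fourier f (k + m)"
  unfolding fourier_def
  by (intro arg_cong[where f = "integral _"] ext) (simp add: exp_add[symmetric] algebra_simps)

lemma fourier_cmult:
  "fourier (\<lambda>x. c * f x) k = c * fourier f k"
proof -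
  have "fourier (\<lambda>x. c * f x) k = integral {0..2*pi} (\<lambda>x. c * (chr k x * f x))"
    by (simp add: fourier_def mult_ac)
  then show ?thesis by (simp add: fourier_def)
qed

lemma telescope_int:
  fixes G :: "int \<Rightarrow> 'a::ab_group_add"
  shows "(\<Sum>k\<in>{- int M..int M}. G (k - 1) - G k) = G (- int M - 1) - G (int M)"
proof (induction M)
  case (Suc M)
  have "{- int (Suc M)..int (Suc M)} = insert (- int M - 1) (insert (int M + 1) {- int M..int M})"
    by auto
  then have "(\<Sum>k\<in>{- int (Suc M)..int (Suc M)}. G (k - 1) - G k)
     = (G (- int M - 2) - G (- int M - 1)) + ((G (int M) - G (int M + 1)) + (\<Sum>k\<in>{- int M..int M}. G (k - 1) - G k))"
    by (simp add: algebra_simps)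
  then show ?case unfolding Suc by (simp add: algebra_simps)
qed auto

text \<open>As y is an interior point, the distance of x and y is below \<open>2 * pi\<close> even
  when x is an endpoint, so 0 is the only multiple left.\<close>

lemma exp_i_diff_eq_1:
  assumes "x \<in> {0..2*pi}" "y \<in> {0<..<2*pi}" "exp (\<i> * of_real (x - y)) = 1"
  shows "x = y"
proof -
  obtain n :: int where n: "x - y = 2 * pi * n"
    using assms(3) unfolding exp_eq_1 by (auto simp: mult_ac)
  have "2 * pi * (-1) < x - y" "x - y < 2 * pi * 1" using assms(1,2) by auto
  then have "2 * pi * (-1) < 2 * pi * real_of_int n" "2 * pi * real_of_int n < 2 * pi * 1" unfolding n .
  then have "-1 < real_of_int n" "real_of_int n < 1"
    using mult_less_cancel_left_pos[of "2 * pi" "-1" "real_of_int n"]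
      mult_less_cancel_left_pos[of "2 * pi" "real_of_int n" 1] pi_gt_zero by auto
  then have "n = 0" by linarith
  then show ?thesis using n by simp
qed

text \<open>The quotient \<open>(f(x) - f(y)) / (exp(i (x - y)) - 1)\<close> turns the partial sums of the series into a telescoping sum.\<close>

lemma fourier_inversion:
  assumes f: "continuous_on {0..2*pi} f" and y: "y \<in> {0<..<2*pi}"
    and d: "(f has_vector_derivative d) (at y)"
  shows "(\<lambda>M::nat. \<Sum>k\<in>{- int M..int M}. fourier f k * chr (- k) y) \<longlonglongrightarrow> of_real (2 * pi) * f y"
proof -
  define w where "w x = exp (\<i> * of_real (x - y)) - 1" for x
  \<comment> \<open>The value at y is the limit of the quotient, since \<open>w\<close> has
    derivative \<open>\<i>\<close> there; hence g is continuous and its coefficients tend to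
    0.\<close>
  define g where "g x = (if x = y then d / \<i> else (f x - f y) / w x)" for x
  have w0: "w x \<noteq> 0" if "x \<in> {0..2*pi}" "x \<noteq> y" for x
    using exp_i_diff_eq_1[of x y] that y by (auto simp: w_def)
  have gw: "f x = f y + g x * w x" if "x \<in> {0..2*pi}" for x
    using w0[OF that] by (auto simp: g_def w_def)
  have cg: "continuous_on {0..2*pi} g"
    unfolding continuous_on_def
  proof
    fix x assume x: "x \<in> {0..2*pi}"
    show "(g \<longlongrightarrow> g x) (at x within {0..2*pi})"
    proof (cases "x = y")
      case True
      have dw: "(w has_vector_derivative \<i>) (at y)"
        using has_vector_derivative_diff_const[THEN iffD2, OF has_vector_derivative_exp_affine[of \<i> "- \<i> * of_real y" y UNIV], of 1]
        by (simp add: w_def[abs_def] algebra_simps)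
      have "((\<lambda>z. ((f z - f y) / of_real (z - y)) / ((w z - w y) / of_real (z - y))) \<longlongrightarrow> d / \<i>) (at y)"
        using d dw by (intro tendsto_divide has_vector_derivative_quotient_limit) auto
      moreover have "\<forall>\<^sub>F z in at y. ((f z - f y) / of_real (z - y)) / ((w z - w y) / of_real (z - y)) = g z"
        unfolding eventually_at_filter
        by (intro always_eventually allI impI) (simp add: g_def w_def del: of_real_diff)
      ultimately have "(g \<longlongrightarrow> d / \<i>) (at y)" by (rule Lim_transform_eventually)
      then show ?thesis unfolding True using tendsto_within_subset[OF _ subset_UNIV] by (simp add: g_def)
    next
      case False
      have "((\<lambda>z. (f z - f y) / w z) \<longlongrightarrow> (f x - f y) / w x) (at x within {0..2*pi})"
        using f x w0[OF x False]
        by (intro tendsto_divide tendsto_diff tendsto_const)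
           (auto simp: continuous_on_def w_def intro!: tendsto_intros)
      moreover have "\<forall>\<^sub>F z in at x within {0..2*pi}. (f z - f y) / w z = g z"
        using tendsto_imp_eventually_ne[OF tendsto_ident_at False] by (rule eventually_mono) (simp add: g_def)
      ultimately have "(g \<longlongrightarrow> (f x - f y) / w x) (at x within {0..2*pi})"
        by (rule Lim_transform_eventually)
      then show ?thesis using False by (simp add: g_def)
    qed
  qed
  define G where "G k = fourier g k * chr (- k) y" for k
  \<comment> \<open>Multiplying g by \<open>w\<close> means shifting its coefficients by one
    frequency and subtracting, which is the difference \<open>G (k - 1) - G k\<close>.\<close>
  have coeff: "fourier f k * chr (- k) y = (if k = 0 then of_real (2 * pi) * f y else 0) + (G (k - 1) - G k)" for k
  proof -
    have "fourier f k = fourier (\<lambda>x. (f y + chr 1 y * (chr (- 1) x * g x)) - g x) k"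
      unfolding fourier_def
    proof (intro integral_cong)
      fix x assume "x \<in> {0..2*pi}"
      then have "f x = f y + g x * w x" by (rule gw)
      also have "\<dots> = f y + chr 1 y * (chr (- 1) x * g x) - g x"
        by (simp add: w_def algebra_simps exp_diff exp_minus divide_inverse)
      finally show "chr k x * f x = chr k x * (f y + chr 1 y * (chr (- 1) x * g x) - g x)" by simp
    qed
    also have "\<dots> = fourier (\<lambda>x. f y + chr 1 y * (chr (- 1) x * g x)) k - fourier g k"
      by (subst fourier_diff) (auto intro!: continuous_intros cg)
    also have "\<dots> = fourier (\<lambda>x. f y) k + chr 1 y * fourier g (k - 1) - fourier g k"
      by (subst fourier_add) (intro continuous_intros cg, intro continuous_intros cg, simp only: fourier_cmult fourier_chr_mult uminus_add_conv_diff add_uminus_conv_diff)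
    finally have *: "fourier f k = fourier (\<lambda>x. f y) k + chr 1 y * fourier g (k - 1) - fourier g k" .
    have "chr 1 y * chr (- k) y = chr (- (k - 1)) y"
      by (simp add: exp_add[symmetric] algebra_simps)
    then show ?thesis unfolding * G_def fourier_const by (auto simp: algebra_simps)
  qed
  have "(\<Sum>k\<in>{- int M..int M}. fourier f k * chr (- k) y) = of_real (2 * pi) * f y + (G (- int M - 1) - G (int M))" for M
    unfolding coeff sum.distrib telescope_int by simp
  moreover have "(\<lambda>M. of_real (2 * pi) * f y + (G (- int M - 1) - G (int M))) \<longlonglongrightarrow> of_real (2 * pi) * f y + (0 - 0)"
  proof (intro tendsto_intros)
    have lim: "(\<lambda>M. G (h M)) \<longlonglongrightarrow> 0" if h: "\<And>M. \<bar>h M\<bar> \<ge> int M" for h :: "nat \<Rightarrow> int"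
    proof (rule LIMSEQ_I)
      fix e :: real assume "e > 0"
      then obtain K where K: "K > 0" "\<And>k. real_of_int \<bar>k\<bar> > K \<Longrightarrow> cmod (fourier g k) < e"
        using riemann_lebesgue[OF cg] by blast
      have "norm (G (h M) - 0) < e" if "M \<ge> nat \<lceil>K\<rceil> + 1" for M
      proof -
        have "K < real M" using that K(1) by linarith
        also have "\<dots> \<le> real_of_int \<bar>h M\<bar>" using h[of M] by linarith
        finally show ?thesis using K(2) by (simp add: G_def norm_mult)
      qed
      then show "\<exists>no. \<forall>n\<ge>no. norm (G (h n) - 0) < e" by blast
    qed
    show "(\<lambda>M. G (- int M - 1)) \<longlonglongrightarrow> 0" "(\<lambda>M. G (int M)) \<longlonglongrightarrow> 0"
      by (rule lim; simp)+
  qed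
  ultimately show ?thesis by simp
qed

section \<open>The coefficients of a square as a convolution\<close>

lemma filterlim_int_intervals:
  "filterlim (\<lambda>M::nat. {- int M..int M}) (finite_subsets_at_top UNIV) sequentially"
  unfolding filterlim_finite_subsets_at_top
proof (intro allI impI)
  fix A :: "int set" assume "finite A \<and> A \<subseteq> UNIV"
  then obtain N where N: "\<And>a. a \<in> A \<Longrightarrow> nat \<bar>a\<bar> \<le> N"
    using finite_imageI[of A "\<lambda>a. nat \<bar>a\<bar>"] by (meson finite_nat_set_iff_bounded_le image_eqI)
  have "A \<subseteq> {- int M..int M}" if "M \<ge> N" for M
    using N that by fastforce
  then show "\<forall>\<^sub>F M in sequentially. finite {- int M..int M} \<and> A \<subseteq> {- int M..int M} \<and> {- int M..int M} \<subseteq> UNIV"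
    unfolding eventually_sequentially by (intro exI[of _ N]) simp
qed

text \<open>Connects the symmetric partial sums of Fourier inversion with unordered sums.\<close>

lemma infsum_int_limit:
  fixes a :: "int \<Rightarrow> 'a::banach"
  assumes "a summable_on UNIV"
  shows "(\<lambda>M::nat. \<Sum>k\<in>{- int M..int M}. a k) \<longlonglongrightarrow> (\<Sum>\<^sub>\<infinity>k. a k)"
  using infsum_tendsto[OF assms] filterlim_compose filterlim_int_intervals by blast

lemma fourier_sum:
  assumes "finite A" "\<And>k. k \<in> A \<Longrightarrow> continuous_on {0..2*pi} (f k)"
  shows "fourier (\<lambda>x. \<Sum>k\<in>A. f k x) n = (\<Sum>k\<in>A. fourier (f k) n)"
  unfolding fourier_def sum_distrib_left
  by (intro integral_sum assms fourier_integrable)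

text \<open>Only one of the two factors f is replaced by a partial sum \<open>S M\<close> of its
  series. The coefficients of \<open>S M * f\<close> are finite sums of shifted coefficients, and
  \<open>S M\<close> converges uniformly. The transform is not normalised, hence the factor
  \<open>2 * pi\<close>.\<close>

lemma fourier_square:
  assumes f: "continuous_on {0..2*pi} f"
    and d: "\<And>y. y \<in> {0<..<2*pi} \<Longrightarrow> (f has_vector_derivative f' y) (at y)"
    and sm: "(\<lambda>k. cmod (fourier f k)) summable_on UNIV"
  shows "of_real (2 * pi) * fourier (\<lambda>x. (f x)\<^sup>2) k = (\<Sum>\<^sub>\<infinity>m. fourier f m * fourier f (k - m))"
proof -
  define c where "c = fourier f"
  define S where "S M x = (\<Sum>m\<in>{- int M..int M}. c m * chr (- m) x)" for M x
  \<comment> \<open>The tail of the absolutely convergent series; it bounds the uniform error of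
    \<open>S M\<close>.\<close>
  define \<tau> where "\<tau> M = (\<Sum>\<^sub>\<infinity>m. cmod (c m)) - (\<Sum>m\<in>{- int M..int M}. cmod (c m))" for M :: nat
  have sm': "(\<lambda>m. cmod (c m)) summable_on UNIV" using sm by (simp add: c_def)
  have \<tau>: "\<tau> \<longlonglongrightarrow> 0"
    using tendsto_diff[OF tendsto_const infsum_int_limit[OF sm'], of "\<Sum>\<^sub>\<infinity>m. cmod (c m)"] by (simp add: \<tau>_def[abs_def])
  have cS: "continuous_on A (S M)" for A M
    unfolding S_def by (intro continuous_intros)
  have diff: "cmod (S M' x - S M x) \<le> \<tau> M" if "M \<le> M'" for M M' x
  proof -
    have sub: "{- int M..int M} \<subseteq> {- int M'..int M'}" using that by auto
    have "S M' x - S M x = (\<Sum>m\<in>{- int M'..int M'} - {- int M..int M}. c m * chr (- m) x)"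
      unfolding S_def using sub by (simp add: sum_diff)
    also have "cmod \<dots> \<le> (\<Sum>m\<in>{- int M'..int M'} - {- int M..int M}. cmod (c m))"
      by (rule sum_norm_le) (simp add: norm_mult)
    also have "\<dots> = (\<Sum>m\<in>{- int M'..int M'}. cmod (c m)) - (\<Sum>m\<in>{- int M..int M}. cmod (c m))"
      using sub by (simp add: sum_diff)
    also have "(\<Sum>m\<in>{- int M'..int M'}. cmod (c m)) \<le> (\<Sum>\<^sub>\<infinity>m. cmod (c m))"
      by (intro finite_sum_le_infsum sm') auto
    finally show ?thesis by (simp add: \<tau>_def)
  qed
  have "cmod (of_real (2 * pi) * f x - S M x) \<le> \<tau> M" if x: "x \<in> {0<..<2*pi}" for x M
  proof (rule tendsto_upperbound[OF tendsto_norm[OF tendsto_diff[OF _ tendsto_const]]])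
    show "(\<lambda>M. S M x) \<longlonglongrightarrow> of_real (2 * pi) * f x"
      unfolding S_def c_def by (rule fourier_inversion[OF f x d[OF x]])
    show "\<forall>\<^sub>F M' in sequentially. cmod (S M' x - S M x) \<le> \<tau> M"
      using diff by (auto simp: eventually_sequentially)
  qed auto
  \<comment> \<open>Inversion is available at interior points only; continuity carries the bound to
    0 and \<open>2 * pi\<close>.\<close>
  then have near: "cmod (of_real (2 * pi) * f x - S M x) \<le> \<tau> M" if "x \<in> {0..2*pi}" for x M
    using that
    by (intro continuous_on_closure_norm_le[of "{0<..<2*pi}" "\<lambda>x. of_real (2 * pi) * f x - S M x"])
       (auto intro!: continuous_intros f cS)
  have "bounded (f ` {0..2*pi})"
    by (intro compact_imp_bounded compact_continuous_image f) auto
  then obtain B where B: "\<And>x. x \<in> {0..2*pi} \<Longrightarrow> cmod (f x) \<le> B"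
    unfolding bounded_iff ball_simps by blast
  have B0: "0 \<le> B" using order_trans[OF norm_ge_zero B[of 0]] by simp
  have part: "fourier (\<lambda>x. S M x * f x) k = (\<Sum>m\<in>{- int M..int M}. c m * c (k - m))" for M
  proof -
    have "fourier (\<lambda>x. S M x * f x) k = fourier (\<lambda>x. \<Sum>m\<in>{- int M..int M}. c m * (chr (- m) x * f x)) k"
      by (simp add: S_def sum_distrib_right mult.assoc)
    also have "\<dots> = (\<Sum>m\<in>{- int M..int M}. c m * c (k - m))"
      by (subst fourier_sum) (auto intro!: continuous_intros f simp only: fourier_cmult fourier_chr_mult c_def add_uminus_conv_diff finite_atLeastAtMost_int)
    finally show ?thesis .
  qed
  have lim: "(\<lambda>M. \<Sum>m\<in>{- int M..int M}. c m * c (k - m)) \<longlonglongrightarrow> of_real (2 * pi) * fourier (\<lambda>x. (f x)\<^sup>2) k"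
  proof (rule Lim_null[THEN iffD2], rule Lim_null_comparison)
    show "(\<lambda>M. 2 * pi * (\<tau> M * B)) \<longlonglongrightarrow> 0"
      using tendsto_mult[OF tendsto_const tendsto_mult[OF \<tau> tendsto_const], of "2 * pi" B] by simp
    have "norm ((\<Sum>m\<in>{- int M..int M}. c m * c (k - m)) - of_real (2 * pi) * fourier (\<lambda>x. (f x)\<^sup>2) k)
        \<le> 2 * pi * (\<tau> M * B)" for M
    proof -
      have "of_real (2 * pi) * fourier (\<lambda>x. (f x)\<^sup>2) k - fourier (\<lambda>x. S M x * f x) k
          = fourier (\<lambda>x. (of_real (2 * pi) * f x - S M x) * f x) k"
        unfolding left_diff_distrib mult.assoc power2_eq_square
        by (subst fourier_diff) (auto intro!: continuous_intros f cS simp only: fourier_cmult)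
      moreover have "cmod (fourier (\<lambda>x. (of_real (2 * pi) * f x - S M x) * f x) k) \<le> 2 * pi * (\<tau> M * B)"
        using near B B0 order_trans[OF norm_ge_zero near[of 0]]
        by (intro fourier_norm_le) (auto intro!: continuous_intros f cS mult_mono simp: norm_mult)
      ultimately show ?thesis unfolding part[symmetric] by (metis norm_minus_commute)
    qed
    then show "\<forall>\<^sub>F M in sequentially. norm ((\<Sum>m\<in>{- int M..int M}. c m * c (k - m)) - of_real (2 * pi) * fourier (\<lambda>x. (f x)\<^sup>2) k)
        \<le> 2 * pi * (\<tau> M * B)" by simp
  qed
  have cb: "cmod (c m) \<le> 2 * pi * B" for m
    unfolding c_def by (rule fourier_norm_le[OF f B])
  have "(\<lambda>m. norm (c m * c (k - m))) summable_on UNIV"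
  proof (rule summable_on_comparison_test[OF summable_on_cmult_left[OF sm', of "2 * pi * B"]])
    show "norm (c m * c (k - m)) \<le> cmod (c m) * (2 * pi * B)" for m
      by (simp add: norm_mult mult_left_mono cb)
  qed auto
  from abs_summable_summable[OF this] have sm2: "(\<lambda>m. c m * c (k - m)) summable_on UNIV" .
  show "of_real (2 * pi) * fourier (\<lambda>x. (f x)\<^sup>2) k = (\<Sum>\<^sub>\<infinity>m. fourier f m * fourier f (k - m))"
    using LIMSEQ_unique[OF lim infsum_int_limit[OF sm2]] by (simp add: c_def)
qed

section \<open>An a priori estimate by differentiation by parts\<close>

lemma mvt_norm_bound:
  fixes f :: "real \<Rightarrow> 'a::real_normed_vector"
  assumes "\<And>x. x \<in> {0..t} \<Longrightarrow> (f has_vector_derivative f' x) (at x within {0..t})"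
    and "\<And>x. x \<in> {0..t} \<Longrightarrow> norm (f' x) \<le> B" and "0 \<le> t"
  shows "norm (f t - f 0) \<le> t * B"
proof -
  have "norm (f t - f 0) \<le> B * norm (t - 0)"
  proof (rule differentiable_bound[where S = "{0..t}" and f' = "\<lambda>x h. h *\<^sub>R f' x"])
    fix x assume x: "x \<in> {0..t}"
    show "(f has_derivative (\<lambda>h. h *\<^sub>R f' x)) (at x within {0..t})"
      using assms(1)[OF x] by (simp add: has_vector_derivative_def)
    show "onorm (\<lambda>h. h *\<^sub>R f' x) \<le> B"
      using assms(2)[OF x] by (intro onorm_bound) (auto simp: mult.commute[of B] intro: mult_left_mono order_trans[OF norm_ge_zero])
  qed (use assms in auto)
  then show ?thesis using assms(3) by (simp add: mult.commute)
qed

section \<open>Convolution of nonnegative summable sequences\<close>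

lemma has_sum_sum_family:
  fixes f :: "'a \<Rightarrow> 'b \<Rightarrow> 'c::topological_comm_monoid_add"
  assumes "finite F" "\<And>k. k \<in> F \<Longrightarrow> (f k has_sum s k) A"
  shows "((\<lambda>m. \<Sum>k\<in>F. f k m) has_sum (\<Sum>k\<in>F. s k)) A"
  using assms by (induction F rule: finite_induct) (auto intro: has_sum_add)

lemma le_infsum_int:
  fixes y :: "int \<Rightarrow> real"
  assumes "y summable_on UNIV" "\<And>m. 0 \<le> y m"
  shows "y m \<le> infsum y UNIV"
  using finite_sum_le_infsum[OF assms(1), of "{m}"] assms(2) by simp

context
  fixes x y :: "int \<Rightarrow> real"
  assumes x: "x summable_on UNIV" "\<And>m. 0 \<le> x m" and y: "y summable_on UNIV" "\<And>m. 0 \<le> y m"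
begin

lemma convolution_summable: "(\<lambda>m. x m * y (k - m)) summable_on UNIV"
  by (rule summable_on_comparison_test[OF summable_on_cmult_left[OF x(1), of "infsum y UNIV"]])
     (use x y le_infsum_int[OF y] in \<open>auto intro: mult_left_mono\<close>)

text \<open>The sum over k moves inside, where it is a finite part of a translate of y. Working with
  finite \<open>F\<close> yields the summability in k along with the bound.\<close>

lemma sum_convolution_le:
  assumes F: "finite F"
  shows "(\<Sum>k\<in>F. \<Sum>\<^sub>\<infinity>m. x m * y (k - m)) \<le> infsum x UNIV * infsum y UNIV"
proof -
  have hs: "((\<lambda>m. \<Sum>k\<in>F. x m * y (k - m)) has_sum (\<Sum>k\<in>F. \<Sum>\<^sub>\<infinity>m. x m * y (k - m))) UNIV"
    by (intro has_sum_sum_family F has_sum_infsum convolution_summable)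
  then have "(\<Sum>k\<in>F. \<Sum>\<^sub>\<infinity>m. x m * y (k - m)) = (\<Sum>\<^sub>\<infinity>m. \<Sum>k\<in>F. x m * y (k - m))"
    by (simp add: infsumI)
  also have "\<dots> \<le> (\<Sum>\<^sub>\<infinity>m. x m * infsum y UNIV)"
  proof (rule infsum_mono)
    show "(\<lambda>m. \<Sum>k\<in>F. x m * y (k - m)) summable_on UNIV"
      using hs by (auto simp: summable_on_def)
    show "(\<lambda>m. x m * infsum y UNIV) summable_on UNIV"
      by (rule summable_on_cmult_left[OF x(1)])
    fix m
    have "(\<Sum>k\<in>F. y (k - m)) = sum y ((\<lambda>k. k - m) ` F)"
      by (subst sum.reindex) (auto simp: inj_on_def)
    also have "\<dots> \<le> infsum y UNIV" using F y by (intro finite_sum_le_infsum) auto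
    finally show "(\<Sum>k\<in>F. x m * y (k - m)) \<le> x m * infsum y UNIV"
      using x(2) by (simp add: mult_left_mono flip: sum_distrib_left)
  qed
  also have "\<dots> = infsum x UNIV * infsum y UNIV" by (rule infsum_cmult_left) (rule x(1))
  finally show ?thesis .
qed

lemma finite_convolution_le:
  assumes "finite F" "finite G"
  shows "(\<Sum>k\<in>F. \<Sum>m\<in>G. x m * y (k - m)) \<le> infsum x UNIV * infsum y UNIV"
proof -
  have "(\<Sum>m\<in>G. x m * y (k - m)) \<le> (\<Sum>\<^sub>\<infinity>m. x m * y (k - m))" for k
    using assms x y by (intro finite_sum_le_infsum convolution_summable) auto
  then show ?thesis using sum_convolution_le[OF assms(1)] by (meson order_trans sum_mono)
qed

lemma convolution_summable': "(\<lambda>k. \<Sum>\<^sub>\<infinity>m. x m * y (k - m)) summable_on UNIV"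
  using x y sum_convolution_le
  by (intro nonneg_bdd_above_summable_on bdd_aboveI[of _ "infsum x UNIV * infsum y UNIV"])
     (auto intro: infsum_nonneg)

lemma infsum_convolution_le: "(\<Sum>\<^sub>\<infinity>k. \<Sum>\<^sub>\<infinity>m. x m * y (k - m)) \<le> infsum x UNIV * infsum y UNIV"
  by (intro infsum_le_finite_sums convolution_summable' sum_convolution_le)

lemma convolution_le: "(\<Sum>\<^sub>\<infinity>m. x m * y (k - m)) \<le> infsum x UNIV * infsum y UNIV"
  using sum_convolution_le[of "{k}"] by simp

end

section \<open>The interaction system and its phases\<close>

lemma one_le_4_pi: "1 \<le> 4 * pi"
  using pi_gt3 by simp

lemma int_abs_ge_1: "real_of_int \<bar>k\<bar> \<ge> 1" if "k \<noteq> 0" for k :: int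
  using that by linarith

text \<open>The number \<open>1 / (4 * pi)\<close> is the factor 1/2 of the nonlinearity times the
  \<open>1 / (2 * pi)\<close> of the convolution formula. The estimates discard it.\<close>

lemma coefficient_le: "cmod (\<i> * of_int k / (4 * of_real pi)) \<le> real_of_int \<bar>k\<bar>"
proof -
  have "real_of_int \<bar>k\<bar> / (4 * pi) \<le> real_of_int \<bar>k\<bar> / 1"
    using one_le_4_pi by (intro divide_left_mono) auto
  then show ?thesis by (simp add: norm_mult norm_divide)
qed

text \<open>The frequency mismatch of the interaction of m and k - m. For \<open>w k = k ^ 3\<close>
  it is the classical \<open>3 * k * m * (k - m)\<close>.\<close>

definition phase :: "(int \<Rightarrow> int) \<Rightarrow> int \<Rightarrow> int \<Rightarrow> int" where
  "phase w k m = w k - w m - w (k - m)"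

definition interaction_sum :: "(int \<Rightarrow> int) \<Rightarrow> real \<Rightarrow> (int \<Rightarrow> complex) \<Rightarrow> int \<Rightarrow> complex" where
  "interaction_sum w t a k = (\<Sum>\<^sub>\<infinity>m. chr (phase w k m) t * (a m * a (k - m)))"

text \<open>
  \<open>U(t, k)\<close> stands for \<open>exp(-i w(k) t) \<F>u(t)(k)\<close>, and \<open>w(k) = k\<^sup>2\<^sup>j\<^sup>+\<^sup>1\<close> for the equation of the theorem.
\<close>

locale interaction =
  fixes T :: real and w :: "int \<Rightarrow> int" and U :: "real \<Rightarrow> int \<Rightarrow> complex" and b :: "int \<Rightarrow> real"
  assumes T: "0 \<le> T"
    and b: "b summable_on UNIV"
    and U_le: "\<And>t k. t \<in> {0..T} \<Longrightarrow> cmod (U t k) \<le> b k"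
    and U_zero: "\<And>t. t \<in> {0..T} \<Longrightarrow> U t 0 = 0"
    and gap: "\<And>k m. \<bar>k * m * (k - m)\<bar> \<le> \<bar>phase w k m\<bar>"
    and U_deriv: "\<And>t k. t \<in> {0..T} \<Longrightarrow> ((\<lambda>\<tau>. U \<tau> k) has_vector_derivative
        - (\<i> * of_int k / (4 * of_real pi)) * interaction_sum w t (U t) k) (at t within {0..T})"
begin

abbreviation "A t \<equiv> (\<Sum>\<^sub>\<infinity>k. cmod (U t k))"
abbreviation "V t k \<equiv> (\<Sum>\<^sub>\<infinity>m. cmod (U t m) * cmod (U t (k - m)))"

lemma b_nonneg: "0 \<le> b k"
  using U_le[of 0 k] T order_trans[OF norm_ge_zero] by auto

lemma U_summable: "t \<in> {0..T} \<Longrightarrow> (\<lambda>k. cmod (U t k)) summable_on UNIV"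
  by (rule summable_on_comparison_test[OF b]) (use U_le in auto)

lemma A_nonneg: "0 \<le> A t"
  by (intro infsum_nonneg) auto

lemma V_nonneg: "0 \<le> V t k"
  by (intro infsum_nonneg) auto

lemma V_summable: "t \<in> {0..T} \<Longrightarrow> V t summable_on UNIV"
  by (rule convolution_summable') (auto simp: U_summable)

lemma V_le: "t \<in> {0..T} \<Longrightarrow> infsum (V t) UNIV \<le> A t * A t"
  by (rule infsum_convolution_le) (auto simp: U_summable)

lemma interaction_sum_le:
  assumes t: "t \<in> {0..T}"
  shows "cmod (interaction_sum w t (U t) k) \<le> V t k"
proof -
  have "(\<lambda>m. norm (chr (phase w k m) t * (U t m * U t (k - m)))) summable_on UNIV"
    using convolution_summable[OF U_summable[OF t] _ U_summable[OF t]] by (simp add: norm_mult)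
  from norm_infsum_bound[OF this] show ?thesis
    by (simp add: interaction_sum_def norm_mult)
qed

lemma U_deriv_le:
  assumes t: "t \<in> {0..T}"
  shows "cmod (- (\<i> * of_int k / (4 * of_real pi)) * interaction_sum w t (U t) k) \<le> real_of_int \<bar>k\<bar> * V t k"
proof -
  have "cmod (\<i> * of_int k / (4 * of_real pi)) \<le> real_of_int \<bar>k\<bar>"
    by (rule coefficient_le)
  then show ?thesis
    unfolding norm_mult norm_minus_cancel
    by (intro mult_mono interaction_sum_le t) auto
qed

text \<open>The majorant b does not depend on time, so the partial sums of the l^1 norm converge
  uniformly.\<close>

lemma continuous_on_A: "continuous_on {0..T} A"
proof (rule uniform_limit_theorem)
  show "uniform_limit {0..T} (\<lambda>F t. \<Sum>k\<in>F. cmod (U t k)) A (finite_subsets_at_top UNIV)"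
    by (rule Weierstrass_m_test_general[OF _ b]) (simp add: U_le)
  have "continuous_on {0..T} (\<lambda>t. U t k)" for k
    using U_deriv by (meson has_vector_derivative_continuous continuous_on_eq_continuous_within)
  then show "\<forall>\<^sub>F F in finite_subsets_at_top UNIV. continuous_on {0..T} (\<lambda>t. \<Sum>k\<in>F. cmod (U t k))"
    by (intro always_eventually allI continuous_intros)
qed auto

text \<open>One finite set of interactions serves all times and all k in \<open>F\<close>.
  Differentiation by parts then concerns finite sums only, and no series has to be differentiated
  term by term.\<close>

lemma interaction_sum_approx:
  assumes "finite F" "e > 0"
  shows "\<exists>G. finite G \<and> (\<forall>k\<in>F. \<forall>t\<in>{0..T}.
    cmod (interaction_sum w t (U t) k - (\<Sum>m\<in>G. chr (phase w k m) t * (U t m * U t (k - m)))) < e)"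
proof -
  have "\<forall>\<^sub>F G in finite_subsets_at_top UNIV. \<forall>t\<in>{0..T}.
    dist (\<Sum>m\<in>G. chr (phase w k m) t * (U t m * U t (k - m))) (interaction_sum w t (U t) k) < e" for k
  proof (rule uniform_limitD)
    show "uniform_limit {0..T} (\<lambda>G t. \<Sum>m\<in>G. chr (phase w k m) t * (U t m * U t (k - m)))
      (\<lambda>t. interaction_sum w t (U t) k) (finite_subsets_at_top UNIV)"
      unfolding interaction_sum_def
    proof (rule Weierstrass_m_test_general)
      show "(\<lambda>m. b m * infsum b UNIV) summable_on UNIV" by (rule summable_on_cmult_left[OF b])
      show "norm (chr (phase w k m) t * (U t m * U t (k - m))) \<le> b m * infsum b UNIV"
        if "t \<in> {0..T}" for m t
        unfolding norm_mult cmod_chr mult_1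
        by (intro mult_mono U_le order_trans[OF U_le le_infsum_int[OF b b_nonneg]] that b_nonneg norm_ge_zero)
    qed
  qed (rule assms)
  then have "\<forall>\<^sub>F G in finite_subsets_at_top UNIV. \<forall>k\<in>F. \<forall>t\<in>{0..T}.
    dist (\<Sum>m\<in>G. chr (phase w k m) t * (U t m * U t (k - m))) (interaction_sum w t (U t) k) < e"
    using assms(1) by (intro eventually_ball_finite) auto
  then show ?thesis
    unfolding eventually_finite_subsets_at_top by (auto simp: dist_norm norm_minus_commute)
qed

text \<open>The primitive in time of the oscillating coefficient. If the phase is 0, division by
  zero makes it 0; this is consistent because \<open>gap\<close> then forces k, m or k - m to be 0,
  so that the interaction itself vanishes.\<close>

definition B :: "int \<Rightarrow> int \<Rightarrow> real \<Rightarrow> complex" where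
  "B k m t = - (\<i> * of_int k / (4 * of_real pi)) / - (\<i> * of_int (phase w k m)) * chr (phase w k m) t"

definition U' :: "real \<Rightarrow> int \<Rightarrow> complex" where
  "U' t k = - (\<i> * of_int k / (4 * of_real pi)) * interaction_sum w t (U t) k"

text \<open>Division by the phase cancels the factor k of the nonlinearity and gains
  \<open>m * (k - m)\<close> on top. This surplus pays for the derivative that falls on either
  factor later.\<close>

lemma B_le:
  assumes "m * (k - m) \<noteq> 0"
  shows "cmod (B k m t) * real_of_int \<bar>m * (k - m)\<bar> \<le> 1"
proof (cases "phase w k m = 0")
  case False
  have "cmod (B k m t) = real_of_int \<bar>k\<bar> / (4 * pi) / real_of_int \<bar>phase w k m\<bar>"
    by (simp add: B_def norm_mult norm_divide)
  also have "\<dots> * real_of_int \<bar>m * (k - m)\<bar> = real_of_int \<bar>k * m * (k - m)\<bar> / real_of_int \<bar>phase w k m\<bar> / (4 * pi)"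
    by (simp add: abs_mult mult_ac)
  also have "\<dots> \<le> 1 / (4 * pi)"
    using gap[of k m] False by (intro divide_right_mono) (auto simp: divide_le_eq_1 simp flip: of_int_abs)
  also have "\<dots> \<le> 1" using one_le_4_pi by simp
  finally show ?thesis .
qed (simp add: B_def)

lemma B_UU_le:
  assumes t: "t \<in> {0..T}"
  shows "cmod (B k m t * (U t m * U t (k - m))) \<le> cmod (U t m) * cmod (U t (k - m))"
proof (cases "m * (k - m) = 0")
  case True
  then show ?thesis using U_zero[OF t] by auto
next
  case False
  have "cmod (B k m t) * 1 \<le> cmod (B k m t) * real_of_int \<bar>m * (k - m)\<bar>"
    using int_abs_ge_1[OF False] by (intro mult_left_mono) auto
  then have "cmod (B k m t) \<le> 1" using B_le[OF False, of t] by linarith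
  then show ?thesis by (simp add: norm_mult mult_left_le_one_le)
qed

text \<open>\<open>U'\<close> costs one factor m or k - m, which the gain in \<open>B\<close>
  absorbs; the other factor of the gain is at least 1. What remains is a convolution of
  \<open>V\<close> with U, cubic and free of derivatives.\<close>

lemma B_U'U_le:
  assumes t: "t \<in> {0..T}"
  shows "cmod (B k m t * (U' t m * U t (k - m))) \<le> V t m * cmod (U t (k - m))"
    "cmod (B k m t * (U t m * U' t (k - m))) \<le> cmod (U t m) * V t (k - m)"
proof -
  show "cmod (B k m t * (U' t m * U t (k - m))) \<le> V t m * cmod (U t (k - m))"
  proof (cases "m * (k - m) = 0")
    case True
    then have "B k m t * (U' t m * U t (k - m)) = 0" "B k m t * (U t m * U' t (k - m)) = 0"
      using U_zero[OF t] by (auto simp: U'_def)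
    then show ?thesis
      using mult_nonneg_nonneg[OF V_nonneg norm_ge_zero] mult_nonneg_nonneg[OF norm_ge_zero V_nonneg]
      by (simp only: norm_zero)
  next
    case False
    have "cmod (B k m t) * real_of_int \<bar>m\<bar> \<le> cmod (B k m t) * real_of_int \<bar>m * (k - m)\<bar>"
      using int_abs_ge_1[of "k - m"] False
      by (intro mult_left_mono) (auto simp: abs_mult intro!: mult_le_cancel_left1[THEN iffD2])
    then have 1: "cmod (B k m t) * real_of_int \<bar>m\<bar> \<le> 1" using B_le[OF False, of t] by linarith
    have "cmod (B k m t) * cmod (U' t m) \<le> cmod (B k m t) * (real_of_int \<bar>m\<bar> * V t m)"
      unfolding U'_def by (intro mult_left_mono U_deriv_le t) auto
    also have "\<dots> \<le> 1 * V t m" unfolding mult.assoc[symmetric] by (intro mult_right_mono 1 V_nonneg)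
    finally show ?thesis by (simp add: norm_mult mult.assoc[symmetric] mult_right_mono)
  qed
  show "cmod (B k m t * (U t m * U' t (k - m))) \<le> cmod (U t m) * V t (k - m)"
  proof (cases "m * (k - m) = 0")
    case True
    then have "B k m t * (U' t m * U t (k - m)) = 0" "B k m t * (U t m * U' t (k - m)) = 0"
      using U_zero[OF t] by (auto simp: U'_def)
    then show ?thesis
      using mult_nonneg_nonneg[OF V_nonneg norm_ge_zero] mult_nonneg_nonneg[OF norm_ge_zero V_nonneg]
      by (simp only: norm_zero)
  next
    case False
    have "cmod (B k m t) * real_of_int \<bar>k - m\<bar> \<le> cmod (B k m t) * real_of_int \<bar>m * (k - m)\<bar>"
      using int_abs_ge_1[of "m"] False
      by (intro mult_left_mono) (auto simp: abs_mult intro!: mult_le_cancel_right1[THEN iffD2])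
    then have 1: "cmod (B k m t) * real_of_int \<bar>k - m\<bar> \<le> 1" using B_le[OF False, of t] by linarith
    have "cmod (B k m t) * cmod (U' t (k - m)) \<le> cmod (B k m t) * (real_of_int \<bar>k - m\<bar> * V t (k - m))"
      unfolding U'_def by (intro mult_left_mono U_deriv_le t) auto
    also have "\<dots> \<le> 1 * V t (k - m)" unfolding mult.assoc[symmetric] by (intro mult_right_mono 1 V_nonneg)
    finally have "cmod (U t m) * (cmod (B k m t) * cmod (U' t (k - m))) \<le> cmod (U t m) * V t (k - m)"
      by (intro mult_left_mono) auto
    then show ?thesis by (simp add: norm_mult mult_ac)
  qed
qed

lemma B_UU_deriv:
  assumes t: "t \<in> {0..T}"
  shows "((\<lambda>t. B k m t * (U t m * U t (k - m))) has_vector_derivative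
    - (\<i> * of_int k / (4 * of_real pi)) * (chr (phase w k m) t * (U t m * U t (k - m)))
    + (B k m t * (U' t m * U t (k - m)) + B k m t * (U t m * U' t (k - m)))) (at t within {0..T})"
proof -
  define c where "c = - (\<i> * of_int k / (4 * complex_of_real pi)) / - (\<i> * of_int (phase w k m))"
  have B: "(B k m has_vector_derivative c * (- (\<i> * of_int (phase w k m)) * chr (phase w k m) t)) (at t within {0..T})"
    unfolding B_def c_def
    by (intro has_vector_derivative_mult_right has_vector_derivative_chr)
  have dU: "((\<lambda>t. U t m) has_vector_derivative U' t m) (at t within {0..T})" for m
    unfolding U'_def by (rule U_deriv[OF t])
  have "((\<lambda>t. B k m t * (U t m * U t (k - m))) has_vector_derivative
     B k m t * (U t m * U' t (k - m) + U' t m * U t (k - m)) +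
     c * (- (\<i> * of_int (phase w k m)) * chr (phase w k m) t) * (U t m * U t (k - m))) (at t within {0..T})"
    by (intro has_vector_derivative_mult B dU)
  moreover have "c * (- (\<i> * of_int (phase w k m)) * chr (phase w k m) t) * (U t m * U t (k - m))
     = - (\<i> * of_int k / (4 * of_real pi)) * (chr (phase w k m) t * (U t m * U t (k - m)))"
  \<comment> \<open>For vanishing phase, \<open>B\<close> contributes nothing, but then k = 0, m = 0
    or m = k, and the right-hand side is 0 as well.\<close>
  proof (cases "phase w k m = 0")
    case True
    then have "k = 0 \<or> m = 0 \<or> k - m = 0" using gap[of k m] by auto
    then show ?thesis using U_zero[OF t] by (auto simp: c_def)
  next
    case False
    then have "c * - (\<i> * of_int (phase w k m)) = - (\<i> * of_int k / (4 * of_real pi))"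
      by (simp add: c_def)
    then show ?thesis by (simp add: mult.assoc[symmetric])
  qed
  ultimately show ?thesis by (simp add: algebra_simps)
qed

text \<open>
  Differentiation by parts: subtracting the boundary terms \<open>B\<close> from \<open>U\<close> turns the quadratic
  nonlinearity, which loses a derivative, into a cubic one that is bounded on \<open>\<ell>\<^sup>1\<close>. The unimodular
  factors \<open>\<theta>\<close> reduce the \<open>\<ell>\<^sup>1\<close> estimate to the mean value inequality for a scalar function.
\<close>

lemma l1_estimate:
  assumes t: "t \<in> {0..T}" and F: "finite F" and R: "\<And>\<tau>. \<tau> \<in> {0..t} \<Longrightarrow> A \<tau> \<le> R"
  shows "(\<Sum>k\<in>F. cmod (U t k - U 0 k)) \<le> 2 * R ^ 2 + 2 * T * R ^ 3"
proof (rule field_le_epsilon)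
  fix e :: real assume e: "e > 0"
  have R0: "0 \<le> R" using R[of 0] A_nonneg[of 0] t by auto
  define L where "L = (\<Sum>k\<in>F. real_of_int \<bar>k\<bar>)"
  have L0: "0 \<le> L" by (auto simp: L_def intro: sum_nonneg)
  \<comment> \<open>The truncation error enters with weight \<open>\<bar>k\<bar>\<close>, summed
    over \<open>F\<close> and integrated up to T; the total is at most e.\<close>
  define e' where "e' = e / (T * L + 1)"
  have TL: "0 < T * L + 1" using T L0 by (simp add: add_nonneg_pos)
  have e': "e' > 0" using e TL by (simp add: e'_def)
  obtain G where G: "finite G" and approx: "\<And>k \<tau>. k \<in> F \<Longrightarrow> \<tau> \<in> {0..T} \<Longrightarrow>
    cmod (interaction_sum w \<tau> (U \<tau>) k - (\<Sum>m\<in>G. chr (phase w k m) \<tau> * (U \<tau> m * U \<tau> (k - m)))) < e'"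
    using interaction_sum_approx[OF F e'] by blast
  define W where "W k \<tau> = U \<tau> k - (\<Sum>m\<in>G. B k m \<tau> * (U \<tau> m * U \<tau> (k - m)))" for k \<tau>
  define W' where "W' k \<tau> = U' \<tau> k - (\<Sum>m\<in>G.
    - (\<i> * of_int k / (4 * of_real pi)) * (chr (phase w k m) \<tau> * (U \<tau> m * U \<tau> (k - m)))
    + (B k m \<tau> * (U' \<tau> m * U \<tau> (k - m)) + B k m \<tau> * (U \<tau> m * U' \<tau> (k - m))))" for k \<tau>
  have dW: "(W k has_vector_derivative W' k \<tau>) (at \<tau> within {0..t})" if "\<tau> \<in> {0..t}" for k \<tau>
  proof (rule has_vector_derivative_within_subset)
    show "(W k has_vector_derivative W' k \<tau>) (at \<tau> within {0..T})"
      unfolding W_def W'_def U'_def[of _ k] using that t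
      by (intro has_vector_derivative_diff has_vector_derivative_sum B_UU_deriv U_deriv) auto
  qed (use t in auto)
  define \<theta> where "\<theta> k = cnj (sgn (W k t - W k 0))" for k
  have \<theta>: "\<theta> k * (W k t - W k 0) = of_real (cmod (W k t - W k 0))" "cmod (\<theta> k) \<le> 1" for k
  proof -
    have "\<theta> k * (W k t - W k 0) = (W k t - W k 0) * cnj (W k t - W k 0) / of_real (cmod (W k t - W k 0))"
      by (simp add: \<theta>_def sgn_eq mult.commute)
    also have "\<dots> = of_real (cmod (W k t - W k 0))"
      by (simp add: complex_norm_square[symmetric] power2_eq_square del: complex_cnj_diff)
    finally show "\<theta> k * (W k t - W k 0) = of_real (cmod (W k t - W k 0))" .
    show "cmod (\<theta> k) \<le> 1" by (simp add: \<theta>_def norm_sgn)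
  qed
  have le_t: "\<tau> \<in> {0..T}" if "\<tau> \<in> {0..t}" for \<tau> using that t by auto
  have W'_le: "cmod (\<Sum>k\<in>F. \<theta> k * W' k \<tau>) \<le> L * e' + 2 * R ^ 3" if \<tau>: "\<tau> \<in> {0..t}" for \<tau>
  proof -
    have \<tau>T: "\<tau> \<in> {0..T}" by (rule le_t[OF \<tau>])
    have *: "cmod (\<theta> k * W' k \<tau>) \<le> real_of_int \<bar>k\<bar> * e'
        + (\<Sum>m\<in>G. V \<tau> m * cmod (U \<tau> (k - m))) + (\<Sum>m\<in>G. cmod (U \<tau> m) * V \<tau> (k - m))"
      if k: "k \<in> F" for k
    proof -
      define X where "X = interaction_sum w \<tau> (U \<tau>) k - (\<Sum>m\<in>G. chr (phase w k m) \<tau> * (U \<tau> m * U \<tau> (k - m)))"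
      \<comment> \<open>The quadratic term of \<open>U'\<close> cancels against the one produced by
        \<open>B\<close>, up to the truncation error \<open>X\<close>. The cubic terms are
        left.\<close>
      have "W' k \<tau> = - (\<i> * of_int k / (4 * of_real pi)) * X
        - ((\<Sum>m\<in>G. B k m \<tau> * (U' \<tau> m * U \<tau> (k - m))) + (\<Sum>m\<in>G. B k m \<tau> * (U \<tau> m * U' \<tau> (k - m))))"
        by (simp only: W'_def X_def U'_def[of \<tau> k] sum.distrib sum_distrib_left[symmetric] right_diff_distrib diff_diff_eq)
      then have "cmod (W' k \<tau>) \<le> cmod (- (\<i> * of_int k / (4 * of_real pi)) * X)
        + (cmod (\<Sum>m\<in>G. B k m \<tau> * (U' \<tau> m * U \<tau> (k - m))) + cmod (\<Sum>m\<in>G. B k m \<tau> * (U \<tau> m * U' \<tau> (k - m))))"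
        by (simp only:) (intro order_trans[OF norm_triangle_ineq4] add_left_mono norm_triangle_ineq)
      moreover have "cmod (- (\<i> * of_int k / (4 * of_real pi)) * X) \<le> real_of_int \<bar>k\<bar> * e'"
        unfolding norm_mult[of _ X] norm_minus_cancel
        using approx[OF k \<tau>T] by (intro mult_mono coefficient_le) (auto simp: X_def)
      moreover have "cmod (\<Sum>m\<in>G. B k m \<tau> * (U' \<tau> m * U \<tau> (k - m))) \<le> (\<Sum>m\<in>G. V \<tau> m * cmod (U \<tau> (k - m)))"
        "cmod (\<Sum>m\<in>G. B k m \<tau> * (U \<tau> m * U' \<tau> (k - m))) \<le> (\<Sum>m\<in>G. cmod (U \<tau> m) * V \<tau> (k - m))"
        by (intro sum_norm_le B_U'U_le \<tau>T)+
      moreover have "cmod (\<theta> k * W' k \<tau>) \<le> cmod (W' k \<tau>)"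
        by (simp add: norm_mult mult_left_le_one_le \<theta>)
      ultimately show ?thesis by linarith
    qed
    have "cmod (\<Sum>k\<in>F. \<theta> k * W' k \<tau>) \<le> (\<Sum>k\<in>F. real_of_int \<bar>k\<bar> * e'
        + (\<Sum>m\<in>G. V \<tau> m * cmod (U \<tau> (k - m))) + (\<Sum>m\<in>G. cmod (U \<tau> m) * V \<tau> (k - m)))"
      by (intro sum_norm_le *)
    also have "\<dots> = L * e' + (\<Sum>k\<in>F. \<Sum>m\<in>G. V \<tau> m * cmod (U \<tau> (k - m)))
        + (\<Sum>k\<in>F. \<Sum>m\<in>G. cmod (U \<tau> m) * V \<tau> (k - m))"
      by (simp add: sum.distrib L_def sum_distrib_right)
    also have "\<dots> \<le> L * e' + infsum (V \<tau>) UNIV * A \<tau> + A \<tau> * infsum (V \<tau>) UNIV"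
      by (intro add_mono order_refl finite_convolution_le F G V_summable U_summable \<tau>T V_nonneg norm_ge_zero)
    also have "\<dots> \<le> L * e' + (A \<tau> * A \<tau>) * A \<tau> + A \<tau> * (A \<tau> * A \<tau>)"
      by (intro add_mono order_refl mult_right_mono mult_left_mono V_le \<tau>T A_nonneg)
    also have "\<dots> \<le> L * e' + (R * R) * R + R * (R * R)"
      by (intro add_mono order_refl mult_mono R \<tau> A_nonneg R0 mult_nonneg_nonneg)
    finally show ?thesis by (simp add: power3_eq_cube algebra_simps)
  qed
  define \<Sigma> where "\<Sigma> = (\<Sum>k\<in>F. cmod (W k t - W k 0))"
  have "\<Sigma> = norm ((\<Sum>k\<in>F. \<theta> k * W k t) - (\<Sum>k\<in>F. \<theta> k * W k 0))"
  proof -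
    have "(\<Sum>k\<in>F. \<theta> k * W k t) - (\<Sum>k\<in>F. \<theta> k * W k 0) = of_real \<Sigma>"
      by (simp add: sum_subtractf[symmetric] right_diff_distrib[symmetric] \<theta> \<Sigma>_def)
    moreover have "0 \<le> \<Sigma>" by (simp add: \<Sigma>_def sum_nonneg)
    ultimately show ?thesis by (simp only: norm_of_real abs_of_nonneg)
  qed
  also have "\<dots> \<le> t * (L * e' + 2 * R ^ 3)"
    using t W'_le
    by (intro mvt_norm_bound[where f' = "\<lambda>\<tau>. \<Sum>k\<in>F. \<theta> k * W' k \<tau>"])
       (auto intro!: has_vector_derivative_sum has_vector_derivative_mult_right dW)
  also have "t * (L * e' + 2 * R ^ 3) \<le> T * (L * e' + 2 * R ^ 3)"
    using t L0 e' R0 by (intro mult_right_mono) auto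
  also have "T * (L * e' + 2 * R ^ 3) \<le> e + 2 * T * R ^ 3"
  proof -
    have "T * L * e' \<le> (T * L + 1) * e'" using e' by (intro mult_right_mono) auto
    also have "\<dots> = e" using TL by (simp add: e'_def)
    finally show ?thesis by (simp add: algebra_simps)
  qed
  finally have 1: "(\<Sum>k\<in>F. cmod (W k t - W k 0)) \<le> e + 2 * T * R ^ 3"
    unfolding \<Sigma>_def .
  \<comment> \<open>The boundary terms occur at time t and at time 0; this is the origin of the
    \<open>2 * R ^ 2\<close> in the conclusion.\<close>
  have bdry: "(\<Sum>k\<in>F. \<Sum>m\<in>G. cmod (B k m \<tau> * (U \<tau> m * U \<tau> (k - m)))) \<le> R ^ 2" if \<tau>: "\<tau> \<in> {0..t}" for \<tau>
  proof -
    have "(\<Sum>k\<in>F. \<Sum>m\<in>G. cmod (B k m \<tau> * (U \<tau> m * U \<tau> (k - m))))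
       \<le> (\<Sum>k\<in>F. \<Sum>m\<in>G. cmod (U \<tau> m) * cmod (U \<tau> (k - m)))"
      by (intro sum_mono B_UU_le le_t \<tau>)
    also have "\<dots> \<le> A \<tau> * A \<tau>"
      by (intro finite_convolution_le F G U_summable le_t \<tau> norm_ge_zero)
    also have "\<dots> \<le> R * R" by (intro mult_mono R \<tau> A_nonneg R0)
    finally show ?thesis by (simp add: power2_eq_square)
  qed
  have "cmod (U t k - U 0 k) \<le> cmod (W k t - W k 0)
      + ((\<Sum>m\<in>G. cmod (B k m t * (U t m * U t (k - m)))) + (\<Sum>m\<in>G. cmod (B k m 0 * (U 0 m * U 0 (k - m)))))" for k
  proof -
    have eq: "U t k - U 0 k = (W k t - W k 0) + ((\<Sum>m\<in>G. B k m t * (U t m * U t (k - m)))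
        - (\<Sum>m\<in>G. B k m 0 * (U 0 m * U 0 (k - m))))"
      by (simp add: W_def)
    have "cmod (U t k - U 0 k) \<le> cmod (W k t - W k 0) + (cmod (\<Sum>m\<in>G. B k m t * (U t m * U t (k - m)))
        + cmod (\<Sum>m\<in>G. B k m 0 * (U 0 m * U 0 (k - m))))"
      unfolding eq by (intro norm_triangle_le add_left_mono norm_triangle_ineq4)
    also have "\<dots> \<le> cmod (W k t - W k 0) + ((\<Sum>m\<in>G. cmod (B k m t * (U t m * U t (k - m))))
        + (\<Sum>m\<in>G. cmod (B k m 0 * (U 0 m * U 0 (k - m)))))"
      by (intro add_left_mono add_mono norm_sum)
    finally show ?thesis .
  qed
  then have "(\<Sum>k\<in>F. cmod (U t k - U 0 k)) \<le> (\<Sum>k\<in>F. cmod (W k t - W k 0))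
      + ((\<Sum>k\<in>F. \<Sum>m\<in>G. cmod (B k m t * (U t m * U t (k - m)))) + (\<Sum>k\<in>F. \<Sum>m\<in>G. cmod (B k m 0 * (U 0 m * U 0 (k - m)))))"
    unfolding sum.distrib[symmetric] by (rule sum_mono)
  also have "\<dots> \<le> (e + 2 * T * R ^ 3) + (R ^ 2 + R ^ 2)"
    using t by (intro add_mono 1 bdry) auto
  finally show "(\<Sum>k\<in>F. cmod (U t k - U 0 k)) \<le> 2 * R ^ 2 + 2 * T * R ^ 3 + e" by simp
qed

end

section \<open>Bootstrap on the whole time interval and cubic expansion\<close>

lemma has_sum_single: "((\<lambda>m. if m = n then c else 0) has_sum c) UNIV"
  for c :: "'a::{comm_monoid_add,topological_space}"
  using has_sum_finite[of "{n}" "\<lambda>m. if m = n then c else 0"]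
  by (subst has_sum_cong_neutral[where T = "{n}"]) auto

context interaction
begin

abbreviation "Y t k \<equiv> U t k - U 0 k"

lemma Y_summable:
  assumes "t \<in> {0..T}"
  shows "(\<lambda>k. cmod (Y t k)) summable_on UNIV"
  by (rule summable_on_comparison_test[OF summable_on_add[OF U_summable[OF assms] U_summable[of 0]]])
     (use T in \<open>auto intro: norm_triangle_ineq4\<close>)

lemma Y_le:
  assumes "t \<in> {0..T}" "\<And>\<tau>. \<tau> \<in> {0..t} \<Longrightarrow> A \<tau> \<le> R"
  shows "(\<Sum>\<^sub>\<infinity>k. cmod (Y t k)) \<le> 2 * R ^ 2 + 2 * T * R ^ 3"
  by (intro infsum_le_finite_sums Y_summable l1_estimate assms)

lemma A_le:
  assumes t: "t \<in> {0..T}"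
  shows "A t \<le> A 0 + (\<Sum>\<^sub>\<infinity>k. cmod (Y t k))"
proof -
  have 0: "0 \<in> {0..T}" using T by auto
  have "A t \<le> (\<Sum>\<^sub>\<infinity>k. cmod (U 0 k) + cmod (Y t k))"
    using norm_triangle_sub
    by (intro infsum_mono summable_on_add U_summable Y_summable t 0)
  also have "\<dots> = A 0 + (\<Sum>\<^sub>\<infinity>k. cmod (Y t k))"
    by (intro infsum_add U_summable Y_summable t 0)
  finally show ?thesis .
qed

text \<open>Continuity argument at the first time \<open>t0\<close> where the l^1 norm reaches
  \<open>2 * a\<close>. Up to that time \<open>Y_le\<close> applies with \<open>R = 2 * a\<close>,
  and by \<open>small\<close> the solution has moved by less than a, which contradicts a norm of
  \<open>2 * a\<close>.\<close>

lemma a_priori_bound: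
  assumes a: "0 < a" "A 0 \<le> a" and small: "2 * (2 * a) ^ 2 + 2 * T * (2 * a) ^ 3 < a"
    and t: "t \<in> {0..T}"
  shows "A t \<le> 2 * a"
proof (rule ccontr)
  assume neg: "\<not> A t \<le> 2 * a"
  define S where "S = {0..T} \<inter> A -` {2 * a..}"
  have "closed S"
    unfolding S_def by (intro continuous_closed_preimage continuous_on_A closed_atLeast closed_real_atLeastAtMost)
  moreover have "bounded S"
    unfolding S_def by (rule bounded_subset[OF bounded_closed_interval[of 0 T]]) auto
  ultimately have "compact S" by (simp add: compact_eq_bounded_closed)
  moreover have "S \<noteq> {}" using neg t by (auto simp: S_def)
  ultimately have "\<exists>t0\<in>S. \<forall>\<tau>\<in>S. t0 \<le> \<tau>" by (rule compact_attains_inf)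
  then obtain t0 where t0: "t0 \<in> S" "\<And>\<tau>. \<tau> \<in> S \<Longrightarrow> t0 \<le> \<tau>" by auto
  have t0T: "t0 \<in> {0..T}" "2 * a \<le> A t0" using t0(1) by (auto simp: S_def)
  \<comment> \<open>Membership in \<open>S\<close> gives only a lower bound at \<open>t0\<close>.
    The intermediate value x is in \<open>S\<close> too, so minimality gives x = \<open>t0\<close>
    and the norm equals \<open>2 * a\<close> there.\<close>
  have "\<exists>x\<ge>0. x \<le> t0 \<and> A x = 2 * a"
    using t0T a by (intro IVT' continuous_on_subset[OF continuous_on_A]) auto
  then obtain x where x: "0 \<le> x" "x \<le> t0" "A x = 2 * a" by blast
  then have "x \<in> S" using t0T by (auto simp: S_def)
  then have x0: "x = t0" using t0(2)[of x] x by auto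
  have "A \<tau> \<le> 2 * a" if "\<tau> \<in> {0..t0}" for \<tau>
  proof (cases "\<tau> = t0")
    case False
    then have "\<tau> \<notin> S" using t0(2)[of \<tau>] that by auto
    then show ?thesis using that t0T by (auto simp: S_def)
  qed (use x x0 in simp)
  then have "(\<Sum>\<^sub>\<infinity>k. cmod (Y t0 k)) \<le> 2 * (2 * a) ^ 2 + 2 * T * (2 * a) ^ 3"
    by (intro Y_le t0T)
  then show False using A_le[OF t0T(1)] small a x(3) unfolding x0 by linarith
qed

text \<open>Two Picard steps, from N and N to 2 N and from 2 N and -N to N. The distance
  \<open>Y\<close> from the data is at most D in l^1, and D is of second order in R; this makes
  every term of the remainder of fourth order.\<close>

lemma cubic_expansion:
  fixes N :: int and p :: complex
  assumes N: "1 \<le> N" and U0: "\<And>k. U 0 k = (if k = N \<or> k = - N then p else 0)"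
    and odd: "w (- N) = - w N"
    and R: "\<And>t. t \<in> {0..T} \<Longrightarrow> A t \<le> R"
    and \<Psi>: "\<Psi> = w (2 * N) - 2 * w N" "\<Psi> \<noteq> 0"
    and D: "D = 2 * R ^ 2 + 2 * T * R ^ 3"
  shows "cmod (U T N - p - p ^ 3 * ((\<i> * of_int N / (2 * of_real pi))\<^sup>2 / (\<i> * of_int \<Psi>))
            * - (of_real T - (chr (- \<Psi>) T - 1) / (\<i> * of_int \<Psi>)))
         \<le> T * (real_of_int N * (D\<^sup>2 + 2 * R * (T * (real_of_int (2 * N) * (2 * R * D)))))"
proof -
  have mem0: "0 \<in> {0..T}" using T by auto
  have R0: "0 \<le> R" using R[OF mem0] A_nonneg[of 0] by linarith
  have D0: "0 \<le> D" using R0 T by (simp add: D)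
  have pR: "cmod p \<le> R"
    using le_infsum_int[OF U_summable[OF mem0], of N] R[OF mem0] by (simp add: U0)
  have YD: "(\<Sum>\<^sub>\<infinity>k. cmod (Y t k)) \<le> D" if "t \<in> {0..T}" for t
    unfolding D using that by (intro Y_le R) auto
  have ph: "phase w (2 * N) N = \<Psi>" "phase w N (- N) = - \<Psi>" "phase w N (2 * N) = - \<Psi>"
    using odd by (simp_all add: phase_def \<Psi>)
  define c where "c k = - (\<i> * of_int k / (4 * complex_of_real pi))" for k :: int
  have c_le: "cmod (c k) \<le> real_of_int \<bar>k\<bar>" for k
    unfolding c_def norm_minus_cancel by (rule coefficient_le)
  \<comment> \<open>At frequency 2 N the only pair of data modes is N and N. All other terms contain
    a factor \<open>Y\<close>, hence are of third order.\<close>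
  have Q2: "cmod (interaction_sum w t (U t) (2 * N) - chr \<Psi> t * p\<^sup>2) \<le> 2 * R * D"
    if t: "t \<in> {0..T}" for t
  proof -
    define r where "r m = chr (phase w (2 * N) m) t * (U 0 m * Y t (2 * N - m) + Y t m * U t (2 * N - m))" for m
    have split: "chr (phase w (2 * N) m) t * (U t m * U t (2 * N - m))
      = (if m = N then chr \<Psi> t * p\<^sup>2 else 0) + r m" for m
    proof -
      have "U t m * U t (2 * N - m) = U 0 m * U 0 (2 * N - m) + (U 0 m * Y t (2 * N - m) + Y t m * U t (2 * N - m))"
        by (simp add: algebra_simps)
      moreover have "U 0 m * U 0 (2 * N - m) = (if m = N then p\<^sup>2 else 0)"
        using N by (auto simp: U0 power2_eq_square)
      ultimately show ?thesis by (auto simp: r_def distrib_left ph)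
    qed
    note s1 = convolution_summable[OF U_summable[OF mem0] norm_ge_zero Y_summable[OF t] norm_ge_zero, of "2 * N"]
    note s2 = convolution_summable[OF Y_summable[OF t] norm_ge_zero U_summable[OF t] norm_ge_zero, of "2 * N"]
    have r_le: "norm (r m) \<le> cmod (U 0 m) * cmod (Y t (2 * N - m)) + cmod (Y t m) * cmod (U t (2 * N - m))" for m
      unfolding r_def norm_mult[of "chr _ _"] cmod_chr mult_1
      by (intro norm_triangle_le) (simp add: norm_mult)
    have rs: "(\<lambda>m. norm (r m)) summable_on UNIV"
      by (rule summable_on_comparison_test[OF summable_on_add[OF s1 s2]]) (simp_all add: r_le)
    have "interaction_sum w t (U t) (2 * N) = chr \<Psi> t * p\<^sup>2 + infsum r UNIV"
      unfolding interaction_sum_def split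
      by (intro infsumI has_sum_add has_sum_single has_sum_infsum abs_summable_summable[OF rs])
    then have "cmod (interaction_sum w t (U t) (2 * N) - chr \<Psi> t * p\<^sup>2) \<le> (\<Sum>\<^sub>\<infinity>m. norm (r m))"
      using norm_infsum_bound[OF rs] by simp
    also have "\<dots> \<le> (\<Sum>\<^sub>\<infinity>m. cmod (U 0 m) * cmod (Y t (2 * N - m)) + cmod (Y t m) * cmod (U t (2 * N - m)))"
      by (intro infsum_mono rs summable_on_add s1 s2 r_le)
    also have "\<dots> = (\<Sum>\<^sub>\<infinity>m. cmod (U 0 m) * cmod (Y t (2 * N - m))) + (\<Sum>\<^sub>\<infinity>m. cmod (Y t m) * cmod (U t (2 * N - m)))"
      by (intro infsum_add s1 s2)
    also have "\<dots> \<le> A 0 * (\<Sum>\<^sub>\<infinity>k. cmod (Y t k)) + (\<Sum>\<^sub>\<infinity>k. cmod (Y t k)) * A t"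
      by (intro add_mono convolution_le U_summable Y_summable t mem0 norm_ge_zero)
    also have "\<dots> \<le> R * D + D * R"
      by (intro add_mono mult_mono R t mem0 YD R0 D0 A_nonneg infsum_nonneg norm_ge_zero)
    finally show ?thesis by (simp add: mult_ac)
  qed
  \<comment> \<open>The second Picard iterate at 2 N: the integral of the leading term from 0 to
    t.\<close>
  define V where "V t = c (2 * N) * p\<^sup>2 * ((chr \<Psi> t - 1) / - (\<i> * of_int \<Psi>))" for t
  have U2: "cmod (U t (2 * N) - V t) \<le> T * (real_of_int (2 * N) * (2 * R * D))"
    if t: "t \<in> {0..T}" for t
  proof -
    have "norm ((U t (2 * N) - V t) - (U 0 (2 * N) - V 0)) \<le> t * (real_of_int (2 * N) * (2 * R * D))"
    proof (rule mvt_norm_bound)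
      fix \<tau> assume "\<tau> \<in> {0..t}"
      then have \<tau>: "\<tau> \<in> {0..T}" using t by auto
      have "(V has_vector_derivative c (2 * N) * p\<^sup>2 * ((- (\<i> * of_int \<Psi>) * chr \<Psi> \<tau>) / - (\<i> * of_int \<Psi>))) (at \<tau> within {0..t})"
        unfolding V_def
        by (intro has_vector_derivative_mult_right has_vector_derivative_divide has_vector_derivative_diff_const[THEN iffD2] has_vector_derivative_chr)
      then have "(V has_vector_derivative c (2 * N) * (chr \<Psi> \<tau> * p\<^sup>2)) (at \<tau> within {0..t})"
        using \<Psi>(2) by (simp add: mult_ac)
      moreover have "((\<lambda>t. U t (2 * N)) has_vector_derivative c (2 * N) * interaction_sum w \<tau> (U \<tau>) (2 * N)) (at \<tau> within {0..t})"
        unfolding c_def using t by (intro has_vector_derivative_within_subset[OF U_deriv[OF \<tau>]]) auto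
      ultimately show "((\<lambda>t. U t (2 * N) - V t) has_vector_derivative
          c (2 * N) * (interaction_sum w \<tau> (U \<tau>) (2 * N) - chr \<Psi> \<tau> * p\<^sup>2)) (at \<tau> within {0..t})"
        unfolding right_diff_distrib by (intro has_vector_derivative_diff)
      show "norm (c (2 * N) * (interaction_sum w \<tau> (U \<tau>) (2 * N) - chr \<Psi> \<tau> * p\<^sup>2)) \<le> real_of_int (2 * N) * (2 * R * D)"
        unfolding norm_mult using N c_le[of "2 * N"] by (intro mult_mono Q2 \<tau>) auto
    qed (use t in auto)
    also have "(U t (2 * N) - V t) - (U 0 (2 * N) - V 0) = U t (2 * N) - V t"
      using N by (simp add: V_def U0)
    also have "t * (real_of_int (2 * N) * (2 * R * D)) \<le> T * (real_of_int (2 * N) * (2 * R * D))"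
      using t N R0 D0 by (intro mult_right_mono) auto
    finally show ?thesis .
  qed
  \<comment> \<open>The remainder is quadratic in \<open>Y\<close> exactly: a data mode at N is
    paired with the vanishing mode 0, and one at -N with 2 N, where the data vanish. The latter pair
    occurs in both orders.\<close>
  have Q1: "cmod (interaction_sum w t (U t) N - 2 * (chr (- \<Psi>) t * (p * U t (2 * N)))) \<le> D\<^sup>2"
    if t: "t \<in> {0..T}" for t
  proof -
    define E where "E = chr (- \<Psi>) t * (p * U t (2 * N))"
    define r where "r m = chr (phase w N m) t * (Y t m * Y t (N - m))" for m
    have split: "chr (phase w N m) t * (U t m * U t (N - m))
      = (if m = - N then E else 0) + (if m = 2 * N then E else 0) + r m" for m
    proof -
      consider "m = - N" | "m = 2 * N" | "m = N" | "m = 0" | "m \<notin> {- N, 2 * N, N, 0}" by blast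
      then show ?thesis
        by cases (use N U_zero[OF t] in \<open>auto simp: r_def U0 E_def ph distrib_left left_diff_distrib right_diff_distrib\<close>)
    qed
    note s = convolution_summable[OF Y_summable[OF t] norm_ge_zero Y_summable[OF t] norm_ge_zero, of N]
    have rs: "(\<lambda>m. norm (r m)) summable_on UNIV"
      unfolding r_def norm_mult cmod_chr mult_1 by (rule s)
    have "interaction_sum w t (U t) N = E + E + infsum r UNIV"
      unfolding interaction_sum_def split
      by (intro infsumI has_sum_add has_sum_single has_sum_infsum abs_summable_summable[OF rs])
    then have "cmod (interaction_sum w t (U t) N - 2 * E) \<le> (\<Sum>\<^sub>\<infinity>m. norm (r m))"
      using norm_infsum_bound[OF rs] by simp
    also have "\<dots> \<le> (\<Sum>\<^sub>\<infinity>k. cmod (Y t k)) * (\<Sum>\<^sub>\<infinity>k. cmod (Y t k))"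
      unfolding r_def norm_mult cmod_chr mult_1
      by (intro convolution_le Y_summable t norm_ge_zero)
    also have "\<dots> \<le> D * D"
      by (intro mult_mono YD t D0 infsum_nonneg norm_ge_zero)
    finally show ?thesis by (simp add: E_def power2_eq_square)
  qed
  \<comment> \<open>The two orders of the pair and the coefficients at N and 2 N multiply to the
    square of \<open>\<i> * of_int N / (2 * of_real pi)\<close>.\<close>
  define K where "K = c N * (2 * p * (c (2 * N) * p\<^sup>2)) / - (\<i> * of_int \<Psi>)"
  define Z where "Z t = K * (of_real t - (chr (- \<Psi>) t - 1) / (\<i> * of_int \<Psi>))" for t
  have dZ: "(Z has_vector_derivative c N * (2 * (chr (- \<Psi>) t * (p * V t)))) (at t within {0..T})" for t
  proof -
    have "(Z has_vector_derivative K * (1 - (- (\<i> * of_int (- \<Psi>)) * chr (- \<Psi>) t) / (\<i> * of_int \<Psi>))) (at t within {0..T})"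
      unfolding Z_def
      by (intro has_vector_derivative_mult_right has_vector_derivative_diff has_vector_derivative_divide
          has_vector_derivative_diff_const[THEN iffD2] has_vector_derivative_chr)
         (use has_vector_derivative_of_real[OF DERIV_ident] in auto)
    moreover have "(- (\<i> * of_int (- \<Psi>)) * chr (- \<Psi>) t) / (\<i> * of_int \<Psi>) = chr (- \<Psi>) t"
      using \<Psi>(2) by simp
    \<comment> \<open>The resonance: the phases of the two steps cancel, and the constant 1
      integrates to a term growing linearly in time.\<close>
    moreover have "chr (- \<Psi>) t * chr \<Psi> t = 1" by (simp flip: exp_add)
    then have "chr (- \<Psi>) t * (chr \<Psi> t - 1) = 1 - chr (- \<Psi>) t"
      by (simp only: right_diff_distrib mult_1_right)
    then have "c N * (2 * (chr (- \<Psi>) t * (p * V t))) = K * (1 - chr (- \<Psi>) t)"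
      unfolding V_def K_def by (simp add: mult_ac)
    ultimately show ?thesis by simp
  qed
  have "norm ((U T N - Z T) - (U 0 N - Z 0)) \<le> T * (real_of_int N * (D\<^sup>2 + 2 * R * (T * (real_of_int (2 * N) * (2 * R * D)))))"
  proof (rule mvt_norm_bound)
    fix t assume t: "t \<in> {0..T}"
    show "((\<lambda>t. U t N - Z t) has_vector_derivative
        c N * interaction_sum w t (U t) N - c N * (2 * (chr (- \<Psi>) t * (p * V t)))) (at t within {0..T})"
      by (intro has_vector_derivative_diff dZ) (use U_deriv[OF t] in \<open>simp add: c_def\<close>)
    have "cmod (interaction_sum w t (U t) N - 2 * (chr (- \<Psi>) t * (p * V t)))
       = cmod ((interaction_sum w t (U t) N - 2 * (chr (- \<Psi>) t * (p * U t (2 * N)))) + 2 * (chr (- \<Psi>) t * (p * (U t (2 * N) - V t))))"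
      by (simp add: algebra_simps)
    also have "\<dots> \<le> D\<^sup>2 + cmod (2 * (chr (- \<Psi>) t * (p * (U t (2 * N) - V t))))"
      by (intro norm_triangle_le add_right_mono Q1 t)
    also have "cmod (2 * (chr (- \<Psi>) t * (p * (U t (2 * N) - V t)))) = 2 * cmod p * cmod (U t (2 * N) - V t)"
      by (simp only: norm_mult cmod_chr mult_1 norm_numeral)
    also have "\<dots> \<le> 2 * R * (T * (real_of_int (2 * N) * (2 * R * D)))"
      using pR R0 by (intro mult_mono U2 t) auto
    finally have "cmod (interaction_sum w t (U t) N - 2 * (chr (- \<Psi>) t * (p * V t)))
       \<le> D\<^sup>2 + 2 * R * (T * (real_of_int (2 * N) * (2 * R * D)))" by simp
    then show "norm (c N * interaction_sum w t (U t) N - c N * (2 * (chr (- \<Psi>) t * (p * V t))))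
       \<le> real_of_int N * (D\<^sup>2 + 2 * R * (T * (real_of_int (2 * N) * (2 * R * D))))"
      unfolding right_diff_distrib[symmetric] norm_mult[of "c N"]
      using c_le[of N] N by (intro mult_mono) auto
  qed (rule T)
  moreover have "U T N - p - p ^ 3 * ((\<i> * of_int N / (2 * of_real pi))\<^sup>2 / (\<i> * of_int \<Psi>))
            * - (of_real T - (chr (- \<Psi>) T - 1) / (\<i> * of_int \<Psi>)) = (U T N - Z T) - (U 0 N - Z 0)"
  proof -
    have "K = - (p ^ 3 * ((\<i> * of_int N / (2 * of_real pi))\<^sup>2 / (\<i> * of_int \<Psi>)))"
      unfolding K_def c_def by (simp add: power2_eq_square power3_eq_cube)
    then have "Z T = p ^ 3 * ((\<i> * of_int N / (2 * of_real pi))\<^sup>2 / (\<i> * of_int \<Psi>))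
            * - (of_real T - (chr (- \<Psi>) T - 1) / (\<i> * of_int \<Psi>))"
      by (simp only: Z_def mult_minus_left mult_minus_right)
    moreover have "Z 0 = 0" "U 0 N = p" by (simp_all add: Z_def U0)
    ultimately show ?thesis by (simp only: diff_zero diff_diff_eq add.commute)
  qed
  ultimately show ?thesis by (simp only:)
qed

end

section \<open>Fourier coefficients of classical solutions\<close>

lemma smooth_periodic_vector_derivative:
  assumes "smooth_periodic f"
  shows "((Dx ^^ n) f has_vector_derivative (Dx ^^ Suc n) f x) (at x within S)"
proof -
  have "(Dx ^^ n) f differentiable (at x)" using assms by (simp add: smooth_periodic_def)
  then have "((Dx ^^ n) f has_vector_derivative (Dx ^^ Suc n) f x) (at x)"
    by (simp add: vector_derivative_works Dx_def)
  then show ?thesis by (rule has_vector_derivative_at_within)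
qed

lemma smooth_periodic_continuous_on:
  assumes "smooth_periodic f"
  shows "continuous_on S ((Dx ^^ n) f)"
  using smooth_periodic_vector_derivative[OF assms]
  by (meson has_vector_derivative_continuous continuous_on_eq_continuous_within)

lemma smooth_periodic_Dx:
  assumes f: "smooth_periodic f"
  shows "smooth_periodic (Dx f)"
proof -
  have "Dx f (x + 2 * pi) = Dx f x" for x
  proof -
    have "(f has_vector_derivative Dx f (x + 2 * pi)) (at (x + 2 * pi))"
      using smooth_periodic_vector_derivative[OF f, of 0] by simp
    then have "(f \<circ> (\<lambda>y. y + 2 * pi) has_vector_derivative (1 *\<^sub>R Dx f (x + 2 * pi))) (at x)"
      by (intro vector_diff_chain_at) (auto intro!: derivative_eq_intros)
    moreover have "f \<circ> (\<lambda>y. y + 2 * pi) = f"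
      using f by (auto simp: smooth_periodic_def)
    ultimately have "(f has_vector_derivative Dx f (x + 2 * pi)) (at x)" by simp
    then show ?thesis by (simp add: Dx_def vector_derivative_at)
  qed
  moreover have "(Dx ^^ n) (Dx f) differentiable (at x)" for n x
    using f unfolding smooth_periodic_def by (metis funpow_swap1 funpow.simps(2) comp_apply)
  ultimately show ?thesis by (simp add: smooth_periodic_def)
qed

lemma smooth_periodic_funpow_Dx: "smooth_periodic f \<Longrightarrow> smooth_periodic ((Dx ^^ n) f)"
  by (induction n) (auto intro: smooth_periodic_Dx)

lemma fourier_funpow_Dx:
  assumes "smooth_periodic f"
  shows "fourier ((Dx ^^ n) f) k = (\<i> * of_int k) ^ n * fourier f k"
proof (induction n)
  case (Suc n)
  have "(Dx ^^ n) f (2 * pi) = (Dx ^^ n) f 0"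
    using smooth_periodic_funpow_Dx[OF assms, of n] unfolding smooth_periodic_def by (metis add_0)
  then have "fourier ((Dx ^^ Suc n) f) k = \<i> * of_int k * fourier ((Dx ^^ n) f) k"
    using fourier_derivative[of "(Dx ^^ n) f" "(Dx ^^ Suc n) f" k]
      smooth_periodic_vector_derivative[OF assms] smooth_periodic_continuous_on[OF assms, of _ "Suc n"] by simp
  then show ?case using Suc by simp
qed simp

section \<open>Decay of the coefficients of smooth functions\<close>

lemma int_inverse_square_summable: "(\<lambda>k::int. 1 / (1 + (real_of_int k)\<^sup>2)) summable_on UNIV"
proof -
  define q where "q k = 1 / (1 + (real_of_int k)\<^sup>2)" for k
  have "summable (\<lambda>n::nat. 1 / (1 + (real n)\<^sup>2))"
  proof (rule summable_comparison_test)
    show "summable (\<lambda>n. inverse (real n ^ 2))" by (rule inverse_power_summable) simp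
    show "\<exists>N. \<forall>n\<ge>N. norm (1 / (1 + (real n)\<^sup>2)) \<le> inverse (real n ^ 2)"
      by (intro exI[of _ 1]) (auto simp: inverse_eq_divide intro!: divide_left_mono mult_pos_pos add_pos_pos)
  qed
  then have *: "(\<lambda>n::nat. 1 / (1 + (real n)\<^sup>2)) summable_on UNIV"
    by (intro norm_summable_imp_summable_on) simp
  have 1: "q summable_on range int"
    using * by (subst summable_on_reindex) (auto simp: q_def o_def)
  have 2: "q summable_on range (\<lambda>n. - int n)"
    using * by (subst summable_on_reindex) (auto simp: q_def o_def inj_on_def)
  have U: "UNIV = range int \<union> (range (\<lambda>n. - int n) - range int)"
    by (auto simp: image_iff) (metis int_cases2)
  show ?thesis
    using summable_on_Un_disjoint[OF 1 summable_on_subset_banach[OF 2, of "range (\<lambda>n. - int n) - range int"]]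
    by (subst U) (auto simp: q_def[abs_def])
qed

text \<open>Two derivatives give decay of order \<open>k^(-2)\<close>, enough for summability over
  the integers. Adding the bound for f itself covers k = 0.\<close>

lemma smooth_periodic_fourier_le:
  assumes f: "smooth_periodic f"
    and B: "\<And>x. x \<in> {0..2*pi} \<Longrightarrow> cmod (f x) \<le> B" "\<And>x. x \<in> {0..2*pi} \<Longrightarrow> cmod ((Dx ^^ 2) f x) \<le> B"
  shows "cmod (fourier f k) \<le> 4 * pi * B / (1 + (real_of_int k)\<^sup>2)"
proof -
  have c: "continuous_on {0..2*pi} f" "continuous_on {0..2*pi} ((Dx ^^ 2) f)"
    using smooth_periodic_continuous_on[OF f, of _ 0] smooth_periodic_continuous_on[OF f, of _ 2] by auto
  have "cmod (fourier ((Dx ^^ 2) f) k) = (real_of_int k)\<^sup>2 * cmod (fourier f k)"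
    unfolding fourier_funpow_Dx[OF f] by (simp add: norm_mult norm_power)
  then have "(1 + (real_of_int k)\<^sup>2) * cmod (fourier f k) \<le> 2 * pi * B + 2 * pi * B"
    using fourier_norm_le[OF c(1) B(1)] fourier_norm_le[OF c(2) B(2)]
    unfolding distrib_right mult_1 by (metis add_mono)
  moreover have "1 + (real_of_int k)\<^sup>2 > 0" by (simp add: add_pos_nonneg)
  ultimately show ?thesis by (simp add: pos_le_divide_eq mult.commute)
qed

lemma smooth_periodic_fourier_summable:
  assumes f: "smooth_periodic f"
  shows "(\<lambda>k. cmod (fourier f k)) summable_on UNIV"
proof -
  have "bounded (f ` {0..2*pi} \<union> (Dx ^^ 2) f ` {0..2*pi})"
    using smooth_periodic_continuous_on[OF f, of _ 0] smooth_periodic_continuous_on[OF f, of _ 2]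
    by (intro bounded_Un[THEN iffD2] conjI compact_imp_bounded compact_continuous_image) auto
  then obtain B where B: "\<And>z. z \<in> f ` {0..2*pi} \<union> (Dx ^^ 2) f ` {0..2*pi} \<Longrightarrow> cmod z \<le> B"
    unfolding bounded_iff by blast
  show ?thesis
    by (rule summable_on_comparison_test[OF summable_on_cmult_right[OF int_inverse_square_summable, of "4 * pi * B"]])
       (use smooth_periodic_fourier_le[OF f, of B] B in auto)
qed

lemma smooth_periodic_fourier_square:
  assumes f: "smooth_periodic f"
  shows "of_real (2 * pi) * fourier (\<lambda>x. (f x)\<^sup>2) k = (\<Sum>\<^sub>\<infinity>m. fourier f m * fourier f (k - m))"
  using smooth_periodic_continuous_on[OF f, of _ 0] smooth_periodic_vector_derivative[OF f, of 0]
  by (intro fourier_square[where f' = "Dx f"] smooth_periodic_fourier_summable f) auto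

text \<open>Joint continuity on a compact rectangle makes the bound uniform in time, which yields
  the majorant b of the interaction system. \<open>C\<close> depends on the solution; quantitative
  control comes from \<open>a_priori_bound\<close> alone.\<close>

lemma classical_solution_fourier_le:
  assumes "classical_solution j T f u"
  obtains C where "\<And>t k. t \<in> {0..T} \<Longrightarrow> cmod (fourier (u t) k) \<le> C / (1 + (real_of_int k)\<^sup>2)"
proof -
  have sp: "\<And>t. t \<in> {0..T} \<Longrightarrow> smooth_periodic (u t)"
    and ct: "\<And>n. continuous_on ({0..T} \<times> UNIV) (\<lambda>(t, x). (Dx ^^ n) (u t) x)"
    using assms by (auto simp: classical_solution_def)
  have "bounded ((\<lambda>(t, x). (Dx ^^ n) (u t) x) ` ({0..T} \<times> {0..2*pi}))" for n
    by (intro compact_imp_bounded compact_continuous_image continuous_on_subset[OF ct] compact_Times) auto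
  then have "bounded ((\<lambda>(t, x). (Dx ^^ 0) (u t) x) ` ({0..T} \<times> {0..2*pi}) \<union> (\<lambda>(t, x). (Dx ^^ 2) (u t) x) ` ({0..T} \<times> {0..2*pi}))"
    by (metis bounded_Un)
  then obtain B where B: "\<And>z. z \<in> (\<lambda>(t, x). (Dx ^^ 0) (u t) x) ` ({0..T} \<times> {0..2*pi}) \<union> (\<lambda>(t, x). (Dx ^^ 2) (u t) x) ` ({0..T} \<times> {0..2*pi}) \<Longrightarrow> cmod z \<le> B"
    unfolding bounded_iff by blast
  have "cmod (fourier (u t) k) \<le> 4 * pi * B / (1 + (real_of_int k)\<^sup>2)" if t: "t \<in> {0..T}" for t k
  proof (rule smooth_periodic_fourier_le[OF sp[OF t]])
    fix x assume x: "x \<in> {0..2*pi}"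
    have "(case (t, x) of (t, x) \<Rightarrow> (Dx ^^ 0) (u t) x) \<in> (\<lambda>(t, x). (Dx ^^ 0) (u t) x) ` ({0..T} \<times> {0..2*pi})"
      "(case (t, x) of (t, x) \<Rightarrow> (Dx ^^ 2) (u t) x) \<in> (\<lambda>(t, x). (Dx ^^ 2) (u t) x) ` ({0..T} \<times> {0..2*pi})"
      using t x by blast+
    then show "cmod (u t x) \<le> B" "cmod ((Dx ^^ 2) (u t) x) \<le> B"
      using B[of "u t x"] B[of "(Dx ^^ 2) (u t) x"] by auto
  qed
  then show thesis using that by blast
qed

lemma classical_solution_fourier_deriv:
  assumes u: "classical_solution j T f u" and t: "t \<in> {0..T}"
  shows "((\<lambda>\<tau>. fourier (u \<tau>) k) has_vector_derivative
     \<i> * of_int (k ^ (2 * j + 1)) * fourier (u t) k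
     - \<i> * of_int k / (4 * of_real pi) * (\<Sum>\<^sub>\<infinity>m. fourier (u t) m * fourier (u t) (k - m)))
     (at t within {0..T})"
proof -
  have sp: "\<And>t. t \<in> {0..T} \<Longrightarrow> smooth_periodic (u t)"
    and ct: "\<And>n. continuous_on ({0..T} \<times> UNIV) (\<lambda>(t, x). (Dx ^^ n) (u t) x)"
    using u by (auto simp: classical_solution_def)
  \<comment> \<open>The time derivative according to the equation, written in iterated
    \<open>Dx\<close> so that the joint continuity demanded by the Leibniz rule follows from
    \<open>ct\<close>.\<close>
  define g where "g t x = - ((-1) ^ (j + 1)) * (Dx ^^ (2 * j + 1)) (u t) x - (Dx ^^ 0) (u t) x * (Dx ^^ 1) (u t) x" for t x
  have dsq: "((\<lambda>y. (u t y)\<^sup>2) has_vector_derivative 2 * (u t x * Dx (u t) x)) (at x within S)"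
    if "t \<in> {0..T}" for t x S
  proof -
    have "(u t has_vector_derivative Dx (u t) x) (at x within S)"
      using smooth_periodic_vector_derivative[OF sp[OF that], of 0] by simp
    from has_vector_derivative_mult[OF this this] show ?thesis by (simp add: power2_eq_square mult_ac)
  qed
  have ut: "((\<lambda>\<tau>. u \<tau> x) has_vector_derivative g t x) (at t within {0..T})" if t: "t \<in> {0..T}" for t x
  proof -
    have Dsq: "Dx (\<lambda>y. (u t y)\<^sup>2) x = 2 * (u t x * Dx (u t) x)"
      unfolding Dx_def by (intro vector_derivative_at) (use dsq[OF t, of x UNIV] in \<open>simp add: Dx_def\<close>)
    obtain ut where ut: "((\<lambda>\<tau>. u \<tau> x) has_vector_derivative ut) (at t within {0..T})"
      "ut + (-1) ^ (j + 1) * (Dx ^^ (2 * j + 1)) (u t) x + 1 / 2 * Dx (\<lambda>y. (u t y)\<^sup>2) x = 0"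
      using u t unfolding classical_solution_def by blast
    have "ut = g t x" using ut(2) unfolding g_def Dsq by (simp add: add_eq_0_iff algebra_simps)
    then show ?thesis using ut(1) by simp
  qed
  have cg: "continuous_on ({0..T} \<times> UNIV) (\<lambda>(t, x). g t x)"
    unfolding g_def case_prod_unfold by (intro continuous_intros ct[unfolded case_prod_unfold])
  have cu: "continuous_on {0..2*pi} (u t)" if "t \<in> {0..T}" for t
    using smooth_periodic_continuous_on[OF sp[OF that], of _ 0] by simp
  have "((\<lambda>\<tau>. integral (cbox 0 (2*pi)) (\<lambda>x. chr k x * u \<tau> x)) has_vector_derivative
        integral (cbox 0 (2*pi)) (\<lambda>x. chr k x * g t x)) (at t within {0..T})"
  proof (rule leibniz_rule_vector_derivative)
    show "((\<lambda>\<tau>. chr k x * u \<tau> x) has_vector_derivative chr k x * g t x) (at t within {0..T})"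
      if "t \<in> {0..T}" for t x
      by (intro has_vector_derivative_mult_right ut that)
    show "(\<lambda>x. chr k x * u t x) integrable_on cbox 0 (2 * pi)" if "t \<in> {0..T}" for t
      using fourier_integrable[OF cu[OF that]] by simp
    show "continuous_on ({0..T} \<times> cbox 0 (2 * pi)) (\<lambda>(t, x). chr k x * g t x)"
      using continuous_on_subset[OF cg, of "{0..T} \<times> cbox 0 (2 * pi)"]
      unfolding case_prod_unfold by (auto intro!: continuous_intros)
  qed (use t in auto)
  then have d: "((\<lambda>\<tau>. fourier (u \<tau>) k) has_vector_derivative fourier (g t) k) (at t within {0..T})"
    by (simp add: fourier_def)
  have c: "continuous_on {0..2*pi} ((Dx ^^ n) (u t))" for n
    by (rule smooth_periodic_continuous_on[OF sp[OF t]])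
  have "fourier (g t) k = - ((-1) ^ (j + 1)) * fourier ((Dx ^^ (2 * j + 1)) (u t)) k
      - fourier (\<lambda>x. (Dx ^^ 0) (u t) x * (Dx ^^ 1) (u t) x) k"
    unfolding g_def
    by (subst fourier_diff) (intro continuous_intros c, intro continuous_intros c, simp only: fourier_cmult)
  moreover have "fourier (\<lambda>x. 2 * (u t x * Dx (u t) x)) k = \<i> * of_int k * fourier (\<lambda>x. (u t x)\<^sup>2) k + ((u t (2 * pi))\<^sup>2 - (u t 0)\<^sup>2)"
    using c[of 0] c[of 1] by (intro fourier_derivative dsq t continuous_intros) auto
  moreover have "u t (2 * pi) = u t 0"
    using sp[OF t] unfolding smooth_periodic_def by (metis add_0)
  ultimately have "fourier (g t) k = - ((-1) ^ (j + 1)) * ((\<i> * of_int k) ^ (2 * j + 1) * fourier (u t) k)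
      - \<i> * of_int k / 2 * fourier (\<lambda>x. (u t x)\<^sup>2) k"
    unfolding fourier_funpow_Dx[OF sp[OF t]] fourier_cmult by (simp add: mult.commute[of _ 2])
  \<comment> \<open>The sign in the equation compensates the power of \<open>\<i>\<close>, so the
    dispersion relation is \<open>k ^ (2 * j + 1)\<close> for every j.\<close>
  also have "- ((-1) ^ (j + 1)) * ((\<i> * of_int k) ^ (2 * j + 1) * fourier (u t) k) = \<i> * of_int (k ^ (2 * j + 1)) * fourier (u t) k"
  proof -
    have "\<i> ^ (2 * j + 1) = (-1) ^ j * \<i>" by (simp add: power_mult)
    moreover have "((-1) ^ j * (-1) ^ j :: complex) = 1" by (simp flip: power_add mult_2)
    ultimately show ?thesis by (simp add: power_mult_distrib mult_ac)
  qed
  also have "\<i> * of_int k / 2 * fourier (\<lambda>x. (u t x)\<^sup>2) k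
     = \<i> * of_int k / (4 * of_real pi) * (\<Sum>\<^sub>\<infinity>m. fourier (u t) m * fourier (u t) (k - m))"
    unfolding smooth_periodic_fourier_square[OF sp[OF t], symmetric] by simp
  finally show ?thesis using d by simp
qed

section \<open>Lower bound for the phases of an odd power\<close>

lemma sum_power_gap_pos:
  fixes a b :: int
  assumes "0 \<le> a" "0 \<le> b"
  shows "a * b * (a + b) \<le> (a + b) ^ (n + 3) - a ^ (n + 3) - b ^ (n + 3)"
proof (cases "a = 0 \<or> b = 0")
  case False
  then have ab: "1 \<le> a" "1 \<le> b" using assms by auto
  show ?thesis
  proof (induction n)
    case 0
    have "(a + b) ^ 3 - a ^ 3 - b ^ 3 = 3 * (a * b * (a + b))"
      by (simp add: power3_eq_cube algebra_simps)
    moreover have "0 \<le> a * b * (a + b)" using assms by simp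
    ultimately show ?case by simp
  next
    case (Suc n)
    define P where "P = a * b * (a + b)"
    have P: "0 \<le> P" using assms by (simp add: P_def)
    have "P + a ^ (n + 3) + b ^ (n + 3) \<le> (a + b) ^ (n + 3)"
      using Suc by (simp add: P_def)
    \<comment> \<open>Raising the exponent multiplies by a + b, which is at least 1; the mixed
      products that appear are nonnegative and are dropped.\<close>
    then have "(a + b) * (P + a ^ (n + 3) + b ^ (n + 3)) \<le> (a + b) * (a + b) ^ (n + 3)"
      using assms by (intro mult_left_mono) auto
    moreover have "P \<le> (a + b) * P" using P ab by (simp add: mult_le_cancel_right1)
    moreover have "0 \<le> b * a ^ (n + 3)" "0 \<le> a * b ^ (n + 3)" using assms by simp_all
    ultimately have "P + a * a ^ (n + 3) + b * b ^ (n + 3) \<le> (a + b) * (a + b) ^ (n + 3)"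
      by (simp add: distrib_left distrib_right)
    then have "P \<le> (a + b) * (a + b) ^ (n + 3) - a * a ^ (n + 3) - b * b ^ (n + 3)" by simp
    then show ?case by (simp only: P_def add_Suc power_Suc)
  qed
qed (auto simp: zero_power)

text \<open>For an odd exponent the expression depends, up to sign, symmetrically on x, y and -(x +
  y). These sum to 0, so two of them have the same weak sign; this reduces everything to nonnegative
  numbers.\<close>

lemma odd_power_gap:
  fixes k m :: int
  assumes j: "1 \<le> j"
  shows "\<bar>k * m * (k - m)\<bar> \<le> \<bar>phase (\<lambda>k. k ^ (2 * j + 1)) k m\<bar>"
proof -
  define n where "n = 2 * (j - 1)"
  have n: "2 * j + 1 = n + 3" "odd (n + 3)" using j by (auto simp: n_def)
  have gap: "\<bar>a * b * (a + b)\<bar> \<le> \<bar>(a + b) ^ (n + 3) - a ^ (n + 3) - b ^ (n + 3)\<bar>"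
    if "0 \<le> a" "0 \<le> b" for a b :: int
    using sum_power_gap_pos[OF that, of n] that by simp
  have neg: "(- a) ^ (n + 3) = - (a ^ (n + 3))" for a :: int
    using n(2) by (rule power_minus_odd)
  have gap': "\<bar>(x + y) * x * y\<bar> \<le> \<bar>(x + y) ^ (n + 3) - x ^ (n + 3) - y ^ (n + 3)\<bar>" for x y :: int
  proof -
    consider "0 \<le> x" "0 \<le> y" | "x \<le> 0" "y \<le> 0" | "0 \<le> x + y" "x \<le> 0" | "x + y \<le> 0" "0 \<le> x"
      | "0 \<le> x + y" "y \<le> 0" | "x + y \<le> 0" "0 \<le> y" by linarith
    then show ?thesis
    proof cases
      case 1 then show ?thesis using gap[of x y] by (simp add: mult_ac)
    next
      case 2
      have "- x + - y = - (x + y)" by simp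
      then show ?thesis using gap[of "- x" "- y"] 2 by (simp only: neg) (simp add: mult_ac abs_minus_commute algebra_simps)
    next
      case 3
      have "(x + y) + - x = y" by simp
      then show ?thesis using gap[of "x + y" "- x"] 3 by (simp only: neg) (simp add: mult_ac abs_minus_commute algebra_simps)
    next
      case 4
      have "- (x + y) + x = - y" by simp
      then show ?thesis using gap[of "- (x + y)" x] 4 by (simp only: neg) (simp add: mult_ac abs_minus_commute algebra_simps)
    next
      case 5
      have "(x + y) + - y = x" by simp
      then show ?thesis using gap[of "x + y" "- y"] 5 by (simp only: neg) (simp add: mult_ac abs_minus_commute algebra_simps)
    next
      case 6
      have "- (x + y) + y = - x" by simp
      then show ?thesis using gap[of "- (x + y)" y] 6 by (simp only: neg) (simp add: mult_ac abs_minus_commute algebra_simps)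
    qed
  qed
  show ?thesis using gap'[of m "k - m"] unfolding phase_def n(1) by simp
qed

text \<open>The factor \<open>chr (w k) t\<close> removes the linear term of the equation, which
  otherwise grows like \<open>k ^ (2 * j + 1)\<close>, and leaves its trace in the phases of the
  quadratic term.\<close>

lemma classical_solution_interaction:
  assumes u: "classical_solution j T f u" and T: "0 \<le> T" and j: "1 \<le> j"
    and zero: "\<And>t. t \<in> {0..T} \<Longrightarrow> fourier (u t) 0 = 0"
  obtains b where "interaction T (\<lambda>k. k ^ (2 * j + 1)) (\<lambda>t k. chr (k ^ (2 * j + 1)) t * fourier (u t) k) b"
proof -
  define w where "w k = k ^ (2 * j + 1)" for k :: int
  define U where "U t k = chr (w k) t * fourier (u t) k" for t k
  obtain C where C: "\<And>t k. t \<in> {0..T} \<Longrightarrow> cmod (fourier (u t) k) \<le> C / (1 + (real_of_int k)\<^sup>2)"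
    using classical_solution_fourier_le[OF u] by blast
  have "interaction T w U (\<lambda>k. C * (1 / (1 + (real_of_int k)\<^sup>2)))"
  proof
    show "(\<lambda>k. C * (1 / (1 + (real_of_int k)\<^sup>2))) summable_on UNIV"
      by (rule summable_on_cmult_right[OF int_inverse_square_summable])
    show "cmod (U t k) \<le> C * (1 / (1 + (real_of_int k)\<^sup>2))" if "t \<in> {0..T}" for t k
      using C[OF that] by (simp add: U_def norm_mult)
    show "U t 0 = 0" if "t \<in> {0..T}" for t using zero[OF that] by (simp add: U_def)
    show "\<bar>k * m * (k - m)\<bar> \<le> \<bar>phase w k m\<bar>" for k m
      unfolding w_def by (rule odd_power_gap[OF j])
    fix t k assume t: "t \<in> {0..T}"
    define q where "q = (\<Sum>\<^sub>\<infinity>m. fourier (u t) m * fourier (u t) (k - m))"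
    have "((\<lambda>\<tau>. U \<tau> k) has_vector_derivative
      chr (w k) t * (\<i> * of_int (w k) * fourier (u t) k - \<i> * of_int k / (4 * of_real pi) * q)
      + (- (\<i> * of_int (w k)) * chr (w k) t) * fourier (u t) k) (at t within {0..T})"
      unfolding U_def w_def q_def
      by (intro has_vector_derivative_mult has_vector_derivative_chr classical_solution_fourier_deriv[OF u t])
    moreover have "interaction_sum w t (U t) k = chr (w k) t * q"
    proof -
      have "chr (phase w k m) t * (U t m * U t (k - m)) = chr (w k) t * (fourier (u t) m * fourier (u t) (k - m))" for m
      proof -
        have "chr (phase w k m) t * chr (w m) t * chr (w (k - m)) t = chr (w k) t"
          by (simp add: phase_def algebra_simps flip: exp_add)
        then show ?thesis by (simp add: U_def mult_ac)
      qed
      then show ?thesis by (simp add: interaction_sum_def q_def infsum_cmult_right')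
    qed
    ultimately show "((\<lambda>\<tau>. U \<tau> k) has_vector_derivative
        - (\<i> * of_int k / (4 * of_real pi)) * interaction_sum w t (U t) k) (at t within {0..T})"
      by (simp add: algebra_simps)
  qed (rule T)
  then show thesis using that unfolding U_def w_def by blast
qed

section \<open>The third derivative of the solution map\<close>

lemma derivative_power_bound:
  fixes f :: "real \<Rightarrow> 'a::real_normed_vector"
  assumes f: "\<And>x. \<bar>x\<bar> < d \<Longrightarrow> (f has_vector_derivative f' x) (at x)"
    and f': "\<And>x. \<bar>x\<bar> < d \<Longrightarrow> norm (f' x) \<le> e * \<bar>x\<bar> ^ n" and e: "0 \<le> e"
    and f0: "f 0 = 0" and x: "\<bar>x\<bar> < d"
  shows "norm (f x) \<le> e * \<bar>x\<bar> ^ Suc n"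
proof -
  have "norm (f x - f 0) \<le> (e * \<bar>x\<bar> ^ n) * norm (x - 0)"
  proof (rule differentiable_bound[where S = "{- \<bar>x\<bar>..\<bar>x\<bar>}" and f' = "\<lambda>x h. h *\<^sub>R f' x"])
    fix y assume y: "y \<in> {- \<bar>x\<bar>..\<bar>x\<bar>}"
    then have yd: "\<bar>y\<bar> < d" "\<bar>y\<bar> \<le> \<bar>x\<bar>" using x by auto
    show "(f has_derivative (\<lambda>h. h *\<^sub>R f' y)) (at y within {- \<bar>x\<bar>..\<bar>x\<bar>})"
      using has_vector_derivative_at_within[OF f[OF yd(1)]] by (simp add: has_vector_derivative_def)
    have "norm (f' y) \<le> e * \<bar>x\<bar> ^ n"
      using f'[OF yd(1)] mult_left_mono[OF power_mono[OF yd(2)] e, of n] by simp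
    then show "onorm (\<lambda>h. h *\<^sub>R f' y) \<le> e * \<bar>x\<bar> ^ n"
      using e by (intro onorm_bound) (auto simp: mult.commute[of "e * _"] intro: mult_left_mono)
  qed auto
  then show ?thesis by (simp add: f0 mult_ac)
qed

text \<open>Since \<open>g2\<close> is differentiable only at 0, Taylor's formula is used in Peano
  form. The expansion is assumed away from 0 and does not mention g(0) or a quadratic term, so
  coefficients cannot be compared one after the other; a finite difference isolates the cubic
  one.\<close>

lemma third_derivative_eq_cubic_coefficient:
  fixes g g1 g2 :: "real \<Rightarrow> complex"
  assumes r: "0 < r"
    and g: "\<And>x. \<bar>x\<bar> < r \<Longrightarrow> (g has_vector_derivative g1 x) (at x)"
    and g1: "\<And>x. \<bar>x\<bar> < r \<Longrightarrow> (g1 has_vector_derivative g2 x) (at x)"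
    and g2: "(g2 has_vector_derivative c) (at 0)"
    and expansion: "\<And>x. x \<noteq> 0 \<Longrightarrow> \<bar>x\<bar> < r \<Longrightarrow> cmod (g x - (of_real x * a + of_real (x ^ 3) * b)) \<le> K * x ^ 4"
  shows "c = 6 * b"
proof -
  define R2 where "R2 x = g2 x - g2 0 - x *\<^sub>R c" for x
  define R1 where "R1 x = g1 x - g1 0 - x *\<^sub>R g2 0 - (x ^ 2 / 2) *\<^sub>R c" for x
  define R0 where "R0 x = g x - g 0 - x *\<^sub>R g1 0 - (x ^ 2 / 2) *\<^sub>R g2 0 - (x ^ 3 / 6) *\<^sub>R c" for x
  have p: "((\<lambda>x. x *\<^sub>R z) has_vector_derivative z) (at x)"
    "((\<lambda>x. (x ^ 2 / 2) *\<^sub>R z) has_vector_derivative x *\<^sub>R z) (at x)"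
    "((\<lambda>x. (x ^ 3 / 6) *\<^sub>R z) has_vector_derivative (x ^ 2 / 2) *\<^sub>R z) (at x)" for z :: complex and x :: real
  proof -
    have "((\<lambda>x. (x ^ 2 / 2)) has_field_derivative x) (at x)" "((\<lambda>x. (x ^ 3 / 6)) has_field_derivative x ^ 2 / 2) (at x)"
      by (auto intro!: derivative_eq_intros)
    from has_vector_derivative_scaleR[OF this(1) has_vector_derivative_const[of z]]
      has_vector_derivative_scaleR[OF this(2) has_vector_derivative_const[of z]]
    show "((\<lambda>x. (x ^ 2 / 2) *\<^sub>R z) has_vector_derivative x *\<^sub>R z) (at x)"
      "((\<lambda>x. (x ^ 3 / 6) *\<^sub>R z) has_vector_derivative (x ^ 2 / 2) *\<^sub>R z) (at x)" by simp_all
    show "((\<lambda>x. x *\<^sub>R z) has_vector_derivative z) (at x)"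
      using has_vector_derivative_scaleR[OF DERIV_ident has_vector_derivative_const[of z]] by simp
  qed
  have d0: "(R0 has_vector_derivative R1 x) (at x)" if "\<bar>x\<bar> < r" for x
    unfolding R0_def R1_def
    by (intro has_vector_derivative_diff p has_vector_derivative_diff_const[THEN iffD2] g that)
  have d1: "(R1 has_vector_derivative R2 x) (at x)" if "\<bar>x\<bar> < r" for x
    unfolding R1_def R2_def
    by (intro has_vector_derivative_diff p has_vector_derivative_diff_const[THEN iffD2] g1 that)
  \<comment> \<open>Differentiability of \<open>g2\<close> at 0 bounds \<open>R2\<close>; the mean
    value inequality lifts the bound twice, to \<open>R1\<close> and \<open>R0\<close>.\<close>
  have R0: "\<exists>d>0. d \<le> r \<and> (\<forall>x. \<bar>x\<bar> < d \<longrightarrow> cmod (R0 x) \<le> e * \<bar>x\<bar> ^ 3)" if e: "e > 0" for e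
  proof -
    have "\<exists>d>0. \<forall>y. norm (y - 0) < d \<longrightarrow> norm (g2 y - g2 0 - (y - 0) *\<^sub>R c) \<le> e * norm (y - 0)"
      using g2 e unfolding has_vector_derivative_def has_derivative_at_alt by blast
    then obtain d where d: "d > 0" "\<And>y. \<bar>y\<bar> < d \<Longrightarrow> cmod (R2 y) \<le> e * \<bar>y\<bar> ^ 1"
      by (auto simp: R2_def)
    have 1: "cmod (R1 x) \<le> e * \<bar>x\<bar> ^ Suc 1" if "\<bar>x\<bar> < min d r" for x
      using d d1 e that by (intro derivative_power_bound[of "min d r" R1 R2]) (auto simp: R1_def)
    have "cmod (R0 x) \<le> e * \<bar>x\<bar> ^ Suc (Suc 1)" if "\<bar>x\<bar> < min d r" for x
      using 1 d0 e that by (intro derivative_power_bound[of "min d r" R0 R1]) (auto simp: R0_def)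
    then show ?thesis using d(1) r by (intro exI[of _ "min d r"]) (auto simp: numeral_3_eq_3)
  qed
  text \<open>The combination below annihilates even and linear terms.\<close>
  define \<Delta> where "\<Delta> f x = f (2 * x) - 2 * f x + 2 * f (- x) - f (- (2 * x))" for f :: "real \<Rightarrow> complex" and x
  have \<Delta>_le: "cmod (\<Delta> f x) \<le> cmod (f (2 * x)) + 2 * cmod (f x) + 2 * cmod (f (- x)) + cmod (f (- (2 * x)))" for f x
    unfolding \<Delta>_def
    by (intro order_trans[OF norm_triangle_ineq4] add_mono order_trans[OF norm_triangle_ineq]) (auto simp: norm_mult)
  define h where "h x = g x - (of_real x * a + of_real (x ^ 3) * b)" for x
  \<comment> \<open>The combination maps \<open>x ^ 3\<close> to \<open>12 * x ^ 3\<close>, so b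
    contributes 12 b and the Taylor coefficient c / 6 contributes 2 c.\<close>
  have \<Delta>_eq: "\<Delta> R0 x = \<Delta> h x + of_real (x ^ 3) * (12 * b - 2 * c)" for x
    unfolding \<Delta>_def R0_def h_def
    by (simp add: scaleR_conv_of_real power2_eq_square power3_eq_cube field_simps)
  have "cmod (12 * b - 2 * c) \<le> 0 + e" if e: "0 < e" for e
  proof -
    \<comment> \<open>The weights add up to 8 + 2 + 2 + 8 = 20 for cubes and 16 + 2 + 2 + 16 = 36
      for fourth powers. Thus \<open>e / 40\<close> and \<open>x \<le> e / (72 * k)\<close> leave e
      / 2 to each part.\<close>
    obtain d where d: "d > 0" "d \<le> r" and R0d: "\<And>x. \<bar>x\<bar> < d \<Longrightarrow> cmod (R0 x) \<le> e / 40 * \<bar>x\<bar> ^ 3"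
      using R0[of "e / 40"] e by auto
    define k where "k = \<bar>K\<bar> + 1"
    have k: "0 < k" "K \<le> k" by (auto simp: k_def)
    define x where "x = min (d / 3) (e / (72 * k))"
    have x: "0 < x" "2 * x < d" "x \<le> e / (72 * k)" using d e k by (auto simp: x_def)
    have "cmod (\<Delta> R0 x) \<le> e / 40 * (2 * x) ^ 3 + 2 * (e / 40 * x ^ 3) + 2 * (e / 40 * x ^ 3) + e / 40 * (2 * x) ^ 3"
      using R0d[of "2 * x"] R0d[of x] R0d[of "- x"] R0d[of "- (2 * x)"] x
      by (intro order_trans[OF \<Delta>_le] add_mono mult_left_mono) auto
    also have "\<dots> = e / 2 * x ^ 3" by (simp add: power_mult_distrib)
    finally have 1: "cmod (\<Delta> R0 x) \<le> e / 2 * x ^ 3" .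
    have "cmod (\<Delta> h x) \<le> K * (2 * x) ^ 4 + 2 * (K * x ^ 4) + 2 * (K * x ^ 4) + K * (2 * x) ^ 4"
      using expansion[of "2 * x"] expansion[of x] expansion[of "- x"] expansion[of "- (2 * x)"] x d
      by (intro order_trans[OF \<Delta>_le] add_mono mult_left_mono) (auto simp: h_def)
    also have "\<dots> = (36 * K * x) * x ^ 3" by (simp add: power_mult_distrib power4_eq_xxxx power3_eq_cube)
    also have "36 * K * x \<le> e / 2"
    proof -
      have "K * x \<le> k * x" using x(1) k by (intro mult_right_mono) auto
      also have "\<dots> \<le> k * (e / (72 * k))" using x(3) k by (intro mult_left_mono) auto
      also have "\<dots> = e / 72" using k by simp
      finally show ?thesis by simp
    qed
    then have "(36 * K * x) * x ^ 3 \<le> e / 2 * x ^ 3" using x(1) by (intro mult_right_mono) auto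
    finally have 2: "cmod (\<Delta> h x) \<le> e / 2 * x ^ 3" .
    have "x ^ 3 * cmod (12 * b - 2 * c) = cmod (\<Delta> R0 x - \<Delta> h x)"
      unfolding \<Delta>_eq using x(1) by (simp add: norm_mult norm_power)
    also have "\<dots> \<le> e * x ^ 3" using norm_triangle_ineq4[of "\<Delta> R0 x" "\<Delta> h x"] 1 2 by simp
    finally show ?thesis using x(1) by (simp add: mult.commute)
  qed
  then have "cmod (12 * b - 2 * c) \<le> 0" by (rule field_le_epsilon)
  then show ?thesis by simp
qed

section \<open>Cosine data and their Sobolev norm\<close>

definition trig :: "int \<Rightarrow> complex \<Rightarrow> complex \<Rightarrow> real \<Rightarrow> complex" where
  "trig N \<alpha> \<beta> x = \<alpha> * chr N x + \<beta> * chr (- N) x"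

lemma has_vector_derivative_trig:
  "(trig N \<alpha> \<beta> has_vector_derivative trig N (- (\<i> * of_int N) * \<alpha>) (\<i> * of_int N * \<beta>) x) (at x)"
proof -
  have "(trig N \<alpha> \<beta> has_vector_derivative
      \<alpha> * (- (\<i> * of_int N) * chr N x) + \<beta> * (- (\<i> * of_int (- N)) * chr (- N) x)) (at x)"
    unfolding trig_def
    by (intro has_vector_derivative_add has_vector_derivative_mult_right has_vector_derivative_chr)
  then show ?thesis by (simp add: trig_def mult_ac)
qed

text \<open>Two independent amplitudes make the family closed under \<open>Dx\<close>, which a
  cosine alone is not.\<close>

lemma funpow_Dx_trig: "(Dx ^^ n) (trig N \<alpha> \<beta>) = trig N ((- (\<i> * of_int N)) ^ n * \<alpha>) ((\<i> * of_int N) ^ n * \<beta>)"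
proof (induction n)
  case (Suc n)
  have "Dx (trig N a b) = trig N (- (\<i> * of_int N) * a) (\<i> * of_int N * b)" for a b
    unfolding Dx_def by (intro ext vector_derivative_at has_vector_derivative_trig)
  then show ?case by (simp add: Suc mult.assoc)
qed simp

lemma smooth_periodic_trig: "smooth_periodic (trig N \<alpha> \<beta>)"
proof -
  have "chr k (x + 2 * pi) = chr k x" for k x
  proof -
    have "chr k (x + 2 * pi) = chr k x * chr k (2 * pi)" by (simp only: exp_add[symmetric]) (simp add: algebra_simps)
    then show ?thesis by (simp only: chr_2pi mult_1_right)
  qed
  then have "trig N \<alpha> \<beta> (x + 2 * pi) = trig N \<alpha> \<beta> x" for x by (simp only: trig_def)
  moreover have "(Dx ^^ n) (trig N \<alpha> \<beta>) differentiable (at x)" for n x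
    unfolding funpow_Dx_trig by (rule differentiableI_vector[OF has_vector_derivative_trig])
  ultimately show ?thesis by (simp add: smooth_periodic_def)
qed

text \<open>The coefficients of \<open>cos (N x)\<close> under the unnormalised transform.\<close>

definition mode :: "int \<Rightarrow> int \<Rightarrow> complex" where
  "mode N k = (if k = N \<or> k = - N then of_real pi else 0)"

lemma fourier_trig:
  assumes "N \<noteq> 0"
  shows "fourier (trig N (of_real (\<delta> / 2)) (of_real (\<delta> / 2))) = \<delta> *\<^sub>R mode N"
proof
  fix k
  have chr: "fourier (chr m) k = (if k = - m then of_real (2 * pi) else 0)" for m
    using fourier_chr_mult[of m "\<lambda>x. 1" k] by (auto simp: fourier_const)
  have "fourier (trig N (of_real (\<delta> / 2)) (of_real (\<delta> / 2))) k
     = of_real (\<delta> / 2) * fourier (chr N) k + of_real (\<delta> / 2) * fourier (chr (- N)) k"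
    unfolding trig_def
    by (subst fourier_add) (intro continuous_intros, intro continuous_intros, simp only: fourier_cmult)
  also have "\<dots> = (\<delta> *\<^sub>R mode N) k"
    unfolding chr using assms by (auto simp: mode_def scaleR_fun_def scaleR_conv_of_real)
  finally show "fourier (trig N (of_real (\<delta> / 2)) (of_real (\<delta> / 2))) k = (\<delta> *\<^sub>R mode N) k" .
qed

lemma mode_Hs:
  assumes N: "1 \<le> N" and X: "X = Hs s \<or> X = real_Hs s"
  shows "c *\<^sub>R mode N \<in> carrier X"
    and "nrm X (c *\<^sub>R mode N) = \<bar>c\<bar> * (sqrt 2 * pi * bracket N powr s)"
proof -
  define f where "f k = bracket k powr (2 * s) * (cmod ((c *\<^sub>R mode N) k))\<^sup>2" for k
  have br: "bracket (- N) = bracket N" by (simp add: bracket_def)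
  have "(f has_sum sum f {N, - N}) (UNIV - {0})"
    using has_sum_finite[of "{N, - N}" f] N
    by (subst has_sum_cong_neutral[where T = "{N, - N}" and g = f])
       (auto simp: f_def mode_def scaleR_fun_def)
  also have "sum f {N, - N} = (\<bar>c\<bar> * (sqrt 2 * pi * bracket N powr s))\<^sup>2"
    using N by (simp add: f_def mode_def scaleR_fun_def br power_mult_distrib powr_double)
  finally have f: "(f has_sum (\<bar>c\<bar> * (sqrt 2 * pi * bracket N powr s))\<^sup>2) (UNIV - {0})" .
  then have "f summable_on (UNIV - {0})" by (auto simp: summable_on_def)
  then have H: "c *\<^sub>R mode N \<in> carrier (Hs s)"
    using N by (auto simp: Hs_def f_def[abs_def] mode_def scaleR_fun_def)
  moreover have "(c *\<^sub>R mode N) (- k) = cnj ((c *\<^sub>R mode N) k)" for k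
    by (auto simp: mode_def scaleR_fun_def)
  ultimately show "c *\<^sub>R mode N \<in> carrier X" using X by (auto simp: real_Hs_def)
  have "0 \<le> \<bar>c\<bar> * (sqrt 2 * pi * bracket N powr s)" by simp
  then have "nrm (Hs s) (c *\<^sub>R mode N) = \<bar>c\<bar> * (sqrt 2 * pi * bracket N powr s)"
    using infsumI[OF f] by (simp add: Hs_def f_def[abs_def])
  then show "nrm X (c *\<^sub>R mode N) = \<bar>c\<bar> * (sqrt 2 * pi * bracket N powr s)"
    using X by (auto simp: real_Hs_def)
qed

section \<open>The third derivative against the cubic coefficient\<close>

lemma linear_fun_apply: "linear (\<lambda>f. f x)" for x :: "'a"
  by (rule linearI) (auto simp: scaleR_fun_def)

text \<open>Along the ray through \<open>\<phi>\<close>, the derivatives of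
  \<open>P \<circ> S\<close> are \<open>D1\<close>, \<open>D2\<close>, \<open>D3\<close> evaluated
  at \<open>\<phi>\<close> in all arguments. Multilinearity makes the third one cubic in the norm q
  of \<open>\<phi>\<close>, with a constant independent of the direction; the contradiction rests on
  this uniformity.\<close>

lemma cubic_coefficient_bound:
  assumes X: "seminormed X" and Y: "seminormed Y" and S: "\<And>v. v \<in> carrier X \<Longrightarrow> S v \<in> carrier Y"
    and r0: "0 < r0"
    and D: "\<And>v. v \<in> carrier X \<Longrightarrow> nrm X v < r0 \<Longrightarrow>
      has_frechet_derivative X Y S (D1 v) v \<and>
      has_frechet_derivative X (blin X Y) D1 (D2 v) v \<and>
      has_frechet_derivative X (blin X (blin X Y)) D2 (D3 v) v"
    and P: "linear P" "\<And>F. F \<in> carrier Y \<Longrightarrow> cmod (P F) \<le> C * nrm Y F" and C: "0 \<le> C"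
    and \<phi>: "\<And>c. c *\<^sub>R \<phi> \<in> carrier X" "\<And>c. nrm X (c *\<^sub>R \<phi>) = \<bar>c\<bar> * q" and r: "0 < r"
    and expansion: "\<And>x. x \<noteq> 0 \<Longrightarrow> \<bar>x\<bar> < r \<Longrightarrow>
      cmod (P (S (x *\<^sub>R \<phi>)) - (of_real x * a + of_real (x ^ 3) * b)) \<le> K * x ^ 4"
  shows "cmod (6 * b) \<le> C * nrm (blin X (blin X (blin X Y))) (D3 0) * q ^ 3"
proof -
  note Y1 = seminormed_blin[OF X Y]
  note Y2 = seminormed_blin[OF X Y1]
  have D3: "D3 0 \<in> carrier (blin X (blin X (blin X Y)))"
    using D[of 0] seminormedD(1,2)[OF X] r0 by (auto simp: has_frechet_derivative_def)
  have \<phi>1: "\<phi> \<in> carrier X" "nrm X \<phi> = q" using \<phi>[of 1] by auto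
  have q: "0 \<le> q" using seminormedD(3)[OF X \<phi>1(1)] \<phi>1(2) by simp
  have app: "cmod (Q (L \<phi>)) \<le> (B * q) * nrm (blin X Z) L"
    if "\<And>F. F \<in> carrier Z \<Longrightarrow> cmod (Q F) \<le> B * nrm Z F" "0 \<le> B" "L \<in> carrier (blin X Z)"
    for Q :: "'d::real_vector \<Rightarrow> complex" and B Z L
  proof -
    have "L \<phi> \<in> carrier Z" using that(3) \<phi>1 by (auto simp: blin_def)
    then have "cmod (Q (L \<phi>)) \<le> B * nrm Z (L \<phi>)" by (rule that(1))
    also have "\<dots> \<le> B * (nrm (blin X Z) L * nrm X \<phi>)"
      by (intro mult_left_mono blin_nrm_bound that \<phi>1 X)
    finally show ?thesis by (simp add: \<phi>1 mult_ac)
  qed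
  \<comment> \<open>Evaluating an operator at \<open>\<phi>\<close> and then applying a functional
    is again a bounded functional, at the cost of one factor q.\<close>
  have P1: "linear (\<lambda>L. P (L \<phi>))" "cmod (P (L \<phi>)) \<le> (C * q) * nrm (blin X Y) L"
    if "L \<in> carrier (blin X Y)" for L
    using linear_compose[OF linear_fun_apply[of \<phi>] P(1)] app[of Y P C L] P(2) C that by (auto simp: o_def)
  have P2: "linear (\<lambda>L. P (L \<phi> \<phi>))" "cmod (P (L \<phi> \<phi>)) \<le> (C * q * q) * nrm (blin X (blin X Y)) L"
    if "L \<in> carrier (blin X (blin X Y))" for L
    using linear_compose[OF linear_fun_apply[of \<phi>] linear_compose[OF linear_fun_apply[of \<phi>] P(1)]]
      app[of "blin X Y" "\<lambda>L. P (L \<phi>)" "C * q" L] P1(2) C q that by (auto simp: o_def)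
  have P3: "cmod (P (L \<phi> \<phi> \<phi>)) \<le> (C * q * q * q) * nrm (blin X (blin X (blin X Y))) L"
    if "L \<in> carrier (blin X (blin X (blin X Y)))" for L
    using app[of "blin X (blin X Y)" "\<lambda>L. P (L \<phi> \<phi>)" "C * q * q" L] P2(2) C q that by auto
  define r' where "r' = min r (r0 / (q + 1))"
  have r': "0 < r'" "r' \<le> r" using r r0 q by (auto simp: r'_def)
  have small: "nrm X (x *\<^sub>R \<phi>) < r0" if "\<bar>x\<bar> < r'" for x
  proof -
    have "\<bar>x\<bar> * q \<le> \<bar>x\<bar> * (q + 1)" by (intro mult_left_mono) auto
    also have "\<dots> < r0" using that q by (simp add: r'_def pos_less_divide_eq)
    finally show ?thesis by (simp add: \<phi>)
  qed
  note Dx = D[OF \<phi>(1) small]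
  have "P (D3 0 \<phi> \<phi> \<phi>) = 6 * b"
  proof (rule third_derivative_eq_cubic_coefficient[OF r'(1), of "\<lambda>x. P (S (x *\<^sub>R \<phi>))"
        "\<lambda>x. P (D1 (x *\<^sub>R \<phi>) \<phi>)" "\<lambda>x. P (D2 (x *\<^sub>R \<phi>) \<phi> \<phi>)"])
    fix x assume x: "\<bar>x\<bar> < r'"
    then have rx: "0 < r' - \<bar>x\<bar>" by simp
    have near: "\<bar>y\<bar> < r'" if "\<bar>y - x\<bar> < r' - \<bar>x\<bar>" for y using that by linarith
    show "((\<lambda>x. P (S (x *\<^sub>R \<phi>))) has_vector_derivative P (D1 (x *\<^sub>R \<phi>) \<phi>)) (at x)"
      using Dx[OF x] S[OF \<phi>(1)] rx P
      by (intro frechet_imp_vector_derivative[where X = X and A = "D1 (x *\<^sub>R \<phi>)" and Z = Y and r = "r' - \<bar>x\<bar>" and C = C and q = q] \<phi> Y) auto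
    have D1c: "D1 (y *\<^sub>R \<phi>) \<in> carrier (blin X Y)" if "\<bar>y - x\<bar> < r' - \<bar>x\<bar>" for y
      using Dx[OF near[OF that]] by (auto simp: has_frechet_derivative_def)
    show "((\<lambda>x. P (D1 (x *\<^sub>R \<phi>) \<phi>)) has_vector_derivative P (D2 (x *\<^sub>R \<phi>) \<phi> \<phi>)) (at x)"
      using Dx[OF x] P1(1)[OF seminormedD(1)[OF Y1]] P1(2) rx D1c
      by (intro frechet_imp_vector_derivative[where X = X and A = "D2 (x *\<^sub>R \<phi>)" and Z = "blin X Y" and r = "r' - \<bar>x\<bar>" and C = "C * q" and q = q
            and P = "\<lambda>L. P (L \<phi>)"] \<phi> Y1) auto
  next
    show "cmod (P (S (x *\<^sub>R \<phi>)) - (of_real x * a + of_real (x ^ 3) * b)) \<le> K * x ^ 4"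
      if "x \<noteq> 0" "\<bar>x\<bar> < r'" for x
      using expansion that r' by simp
  next
    have D2c: "D2 (y *\<^sub>R \<phi>) \<in> carrier (blin X (blin X Y))" if "\<bar>y - 0\<bar> < r'" for y
      using Dx[of y] that by (auto simp: has_frechet_derivative_def)
    show "((\<lambda>x. P (D2 (x *\<^sub>R \<phi>) \<phi> \<phi>)) has_vector_derivative P (D3 0 \<phi> \<phi> \<phi>)) (at 0)"
      using Dx[of 0] P2(1)[OF seminormedD(1)[OF Y2]] P2(2) r' D2c
      by (intro frechet_imp_vector_derivative[where X = X and A = "D3 0" and Z = "blin X (blin X Y)" and r = r' and C = "C * q * q" and q = q
            and P = "\<lambda>L. P (L \<phi> \<phi>)"] \<phi> Y2) auto
  qed
  then show ?thesis using P3[OF D3] by (simp add: power3_eq_cube mult_ac)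
qed

text \<open>Returns from U to the coefficients of u and fixes admissible amplitudes. The remainder
  grows with N, which is harmless because \<open>\<delta>\<close> tends to 0 for fixed N.\<close>

lemma solution_cubic_expansion:
  fixes N :: int and j :: nat and T \<delta> :: real
  defines "\<Psi> \<equiv> (2 * N) ^ (2 * j + 1) - 2 * N ^ (2 * j + 1)"
  defines "\<beta> \<equiv> (\<i> * of_int N / (2 * of_real pi))\<^sup>2 / (\<i> * of_int \<Psi>)
      * - (of_real T - (chr (- \<Psi>) T - 1) / (\<i> * of_int \<Psi>))"
  assumes u: "classical_solution j T f u" and f: "fourier f = \<delta> *\<^sub>R mode N"
    and N: "1 \<le> N" and j: "1 \<le> j" and T: "0 \<le> T"
    and zero: "\<And>t. t \<in> {0..T} \<Longrightarrow> fourier (u t) 0 = 0"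
    and \<delta>: "\<delta> \<noteq> 0" "2 * pi * \<bar>\<delta>\<bar> * (8 + 16 * T) < 1"
    and \<Psi>0: "\<Psi> \<noteq> 0"
  shows "cmod (fourier (u T) N - (of_real \<delta> * (chr (- (N ^ (2 * j + 1))) T * of_real pi)
      + of_real (\<delta> ^ 3) * (chr (- (N ^ (2 * j + 1))) T * (of_real pi ^ 3 * \<beta>))))
    \<le> T * (real_of_int N * ((2 + 2 * T)\<^sup>2 + 8 * real_of_int N * T * (2 + 2 * T))) * (4 * pi) ^ 4 * \<delta> ^ 4"
proof -
  define w where "w k = k ^ (2 * j + 1)" for k :: int
  define U where "U t k = chr (w k) t * fourier (u t) k" for t k
  obtain b where "interaction T w U b"
    using classical_solution_interaction[OF u T j zero] unfolding w_def U_def by blast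
  then interpret interaction T w U b .
  have "u 0 = f" using u by (auto simp: classical_solution_def)
  then have U0: "U 0 k = (if k = N \<or> k = - N then of_real (\<delta> * pi) else 0)" for k
    by (simp add: U_def f mode_def scaleR_fun_def scaleR_conv_of_real)
  \<comment> \<open>The l^1 norm of the data: two coefficients of modulus
    \<open>pi * \<bar>\<delta>\<bar>\<close>. The condition on \<open>\<delta>\<close> says
    \<open>a * (8 + 16 * T) < 1\<close>, which yields the smallness needed for the bootstrap since a
    < 1.\<close>
  define a where "a = 2 * pi * \<bar>\<delta>\<bar>"
  have a: "0 < a" using \<delta> by (simp add: a_def)
  have a8: "a * 8 + a * (16 * T) < 1" using \<delta>(2) by (simp add: a_def distrib_left)
  have a1: "a < 1 / 8" 
  proof -
    have "0 \<le> a * (16 * T)" using a T by simp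
    then show ?thesis using a8 by linarith
  qed
  have "A 0 = (\<Sum>\<^sub>\<infinity>k\<in>{N, - N}. cmod (U 0 k))"
    by (rule infsum_cong_neutral) (auto simp: U0)
  also have "\<dots> = a" using N by (simp add: U0 a_def norm_mult)
  finally have A0: "A 0 \<le> a" by simp
  have "2 * (2 * a) ^ 2 + 2 * T * (2 * a) ^ 3 = a * (a * 8) + (a * (a * (16 * T))) * a"
    by (simp add: power2_eq_square power3_eq_cube)
  also have "\<dots> \<le> a * (a * 8) + (a * (a * (16 * T))) * 1"
    using a a1 T by (intro add_left_mono mult_left_mono) auto
  also have "\<dots> = a * (a * 8 + a * (16 * T))" by (simp add: distrib_left)
  also have "\<dots> < a * 1" using a a8 by (intro mult_strict_left_mono)
  finally have small: "2 * (2 * a) ^ 2 + 2 * T * (2 * a) ^ 3 < a" by simp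
  \<comment> \<open>With \<open>R \<le> 1\<close> the cubic part of D is dominated by its quadratic
    part, so D is at most a constant times \<open>R ^ 2\<close>.\<close>
  define R where "R = 2 * a"
  have R: "0 \<le> R" "R \<le> 1" using a a1 by (auto simp: R_def)
  have R4: "R ^ 4 = (4 * pi) ^ 4 * \<delta> ^ 4" by (simp add: R_def a_def power_mult_distrib)
  define D where "D = 2 * R ^ 2 + 2 * T * R ^ 3"
  have "T * R ^ 3 \<le> T * R ^ 2" using R T by (intro mult_left_mono power_decreasing) auto
  then have D: "0 \<le> D" "D \<le> (2 + 2 * T) * R ^ 2" using R T by (auto simp: D_def distrib_right)
  have odd: "w (- N) = - w N" by (simp add: w_def)
  have \<Psi>: "\<Psi> = w (2 * N) - 2 * w N" by (simp add: \<Psi>_def w_def)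
  have "cmod (U T N - of_real (\<delta> * pi) - (of_real (\<delta> * pi)) ^ 3 * ((\<i> * of_int N / (2 * of_real pi))\<^sup>2 / (\<i> * of_int \<Psi>))
            * - (of_real T - (chr (- \<Psi>) T - 1) / (\<i> * of_int \<Psi>)))
         \<le> T * (real_of_int N * (D\<^sup>2 + 2 * R * (T * (real_of_int (2 * N) * (2 * R * D)))))"
    by (rule cubic_expansion[OF N U0 odd _ \<Psi> \<Psi>0 D_def])
       (use a_priori_bound[OF a A0 small] in \<open>simp add: R_def\<close>)
  then have 1: "cmod (U T N - of_real (\<delta> * pi) - (of_real (\<delta> * pi)) ^ 3 * \<beta>)
         \<le> T * (real_of_int N * (D\<^sup>2 + 2 * R * (T * (real_of_int (2 * N) * (2 * R * D)))))"
    unfolding \<beta>_def mult.assoc .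
  have D2: "D\<^sup>2 \<le> (2 + 2 * T)\<^sup>2 * R ^ 4"
    using power_mono[OF D(2,1), of 2] by (simp add: power_mult_distrib)
  have "2 * R * (T * (real_of_int (2 * N) * (2 * R * D))) = (8 * real_of_int N * T * R ^ 2) * D"
    by (simp add: power2_eq_square)
  also have "\<dots> \<le> (8 * real_of_int N * T * R ^ 2) * ((2 + 2 * T) * R ^ 2)"
    using N T D by (intro mult_left_mono) auto
  also have "\<dots> = 8 * real_of_int N * T * (2 + 2 * T) * R ^ 4"
    by (simp add: power2_eq_square power4_eq_xxxx)
  finally have "D\<^sup>2 + 2 * R * (T * (real_of_int (2 * N) * (2 * R * D)))
      \<le> ((2 + 2 * T)\<^sup>2 + 8 * real_of_int N * T * (2 + 2 * T)) * R ^ 4"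
    using D2 by (simp only: distrib_right add_mono)
  then have "T * (real_of_int N * (D\<^sup>2 + 2 * R * (T * (real_of_int (2 * N) * (2 * R * D)))))
      \<le> T * (real_of_int N * (((2 + 2 * T)\<^sup>2 + 8 * real_of_int N * T * (2 + 2 * T)) * R ^ 4))"
    using N T by (intro mult_left_mono) auto
  with 1 have 2: "cmod (U T N - of_real (\<delta> * pi) - (of_real (\<delta> * pi)) ^ 3 * \<beta>)
      \<le> T * (real_of_int N * (((2 + 2 * T)\<^sup>2 + 8 * real_of_int N * T * (2 + 2 * T)) * R ^ 4))" by linarith
  \<comment> \<open>Undoing the rotation multiplies both coefficients of the expansion by the same
    unimodular number, so their moduli stay the same.\<close>
  have "chr (- w N) T * chr (w N) T = 1" by (simp flip: exp_add)
  then have "fourier (u T) N = chr (- w N) T * U T N"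
    by (simp add: U_def mult.assoc[symmetric])
  then have "fourier (u T) N - (of_real \<delta> * (chr (- w N) T * of_real pi) + of_real (\<delta> ^ 3) * (chr (- w N) T * (of_real pi ^ 3 * \<beta>)))
    = chr (- w N) T * (U T N - of_real (\<delta> * pi) - (of_real (\<delta> * pi)) ^ 3 * \<beta>)"
    by (simp add: right_diff_distrib left_diff_distrib power_mult_distrib mult_ac)
  then have "cmod (fourier (u T) N - (of_real \<delta> * (chr (- w N) T * of_real pi) + of_real (\<delta> ^ 3) * (chr (- w N) T * (of_real pi ^ 3 * \<beta>))))
    = cmod (U T N - of_real (\<delta> * pi) - (of_real (\<delta> * pi)) ^ 3 * \<beta>)"
    by (simp only: norm_mult cmod_chr mult_1)
  with 2 show ?thesis unfolding w_def R4 by (simp only: mult.assoc)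
qed

text \<open>The oscillating part is at most \<open>2 / \<Psi>\<close>. For \<open>\<Psi>\<close> at
  least \<open>4 / T\<close> this is half of the linearly growing part T, so half of the resonance
  survives.\<close>

lemma resonant_coefficient_lower_bound:
  fixes N \<Psi> :: int and T :: real
  assumes T: "0 < T" and \<Psi>: "4 / T \<le> real_of_int \<Psi>"
  shows "(real_of_int N)\<^sup>2 * T / (8 * pi\<^sup>2 * real_of_int \<Psi>) \<le>
    cmod ((\<i> * of_int N / (2 * of_real pi))\<^sup>2 / (\<i> * of_int \<Psi>)
      * - (of_real T - (chr (- \<Psi>) T - 1) / (\<i> * of_int \<Psi>)))"
proof -
  have \<Psi>0: "0 < real_of_int \<Psi>" using T \<Psi> by (smt (verit) divide_pos_pos)
  have "cmod ((chr (- \<Psi>) T - 1) / (\<i> * of_int \<Psi>)) \<le> 2 / real_of_int \<Psi>"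
    using norm_triangle_ineq4[of "chr (- \<Psi>) T" 1] \<Psi>0
    by (simp add: norm_divide norm_mult divide_right_mono)
  also have "\<dots> \<le> T / 2" using T \<Psi> \<Psi>0 by (simp add: field_simps)
  finally have "T / 2 \<le> cmod (of_real T) - cmod ((chr (- \<Psi>) T - 1) / (\<i> * of_int \<Psi>))"
    using T by simp
  also have "\<dots> \<le> cmod (of_real T - (chr (- \<Psi>) T - 1) / (\<i> * of_int \<Psi>))"
    by (rule norm_triangle_ineq2)
  finally have 1: "T / 2 \<le> cmod (of_real T - (chr (- \<Psi>) T - 1) / (\<i> * of_int \<Psi>))" .
  have "(real_of_int N)\<^sup>2 * T / (8 * pi\<^sup>2 * real_of_int \<Psi>) = (real_of_int N)\<^sup>2 / (4 * pi\<^sup>2) / real_of_int \<Psi> * (T / 2)"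
    by simp
  also have "\<dots> \<le> (real_of_int N)\<^sup>2 / (4 * pi\<^sup>2) / real_of_int \<Psi> * cmod (of_real T - (chr (- \<Psi>) T - 1) / (\<i> * of_int \<Psi>))"
    using \<Psi>0 by (intro mult_left_mono 1) auto
  also have "(real_of_int N)\<^sup>2 / (4 * pi\<^sup>2) / real_of_int \<Psi> = cmod ((\<i> * of_int N / (2 * of_real pi))\<^sup>2 / (\<i> * of_int \<Psi>))"
    using \<Psi>0 by (simp add: norm_divide norm_mult norm_power power_divide power_mult_distrib)
  finally show ?thesis by (simp only: norm_mult norm_minus_cancel)
qed

text \<open>The lower bound makes the oscillating part small for large N; the upper bound keeps the
  cubic coefficient, which carries \<open>1 / \<Psi>\<close>, from being too small.\<close>

lemma resonance_function_bounds:
  fixes N :: int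
  assumes N: "1 \<le> N" and j: "1 \<le> j"
  shows "N \<le> (2 * N) ^ (2 * j + 1) - 2 * N ^ (2 * j + 1)"
    and "(2 * N) ^ (2 * j + 1) - 2 * N ^ (2 * j + 1) \<le> 2 ^ (2 * j + 1) * N ^ (2 * j + 1)"
proof -
  have "(2::int) ^ 2 \<le> 2 ^ (2 * j + 1)" using j by (intro power_increasing) auto
  then have "3 * N ^ (2 * j + 1) \<le> 2 ^ (2 * j + 1) * N ^ (2 * j + 1)"
    using N by (intro mult_right_mono) auto
  moreover have "N \<le> N ^ (2 * j + 1)" using N by (intro self_le_power) auto
  ultimately show "N \<le> (2 * N) ^ (2 * j + 1) - 2 * N ^ (2 * j + 1)"
    unfolding power_mult_distrib by linarith
  show "(2 * N) ^ (2 * j + 1) - 2 * N ^ (2 * j + 1) \<le> 2 ^ (2 * j + 1) * N ^ (2 * j + 1)"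
    unfolding power_mult_distrib using N by simp
qed

section \<open>Growth rates in N\<close>

theorem theorem1p2:
  fixes j :: nat and s T :: real
    and X :: "(int \<Rightarrow> complex) nspace"
    and S :: "(int \<Rightarrow> complex) \<Rightarrow> real \<Rightarrow> int \<Rightarrow> complex"
  assumes "j \<ge> 2"
    and "s < - real j + 1 / 2"
    and "T > 0"
    and "X = Hs s \<or> X = real_Hs s"
    and "solution_map j T X S"
  shows "\<not> C3_at X (C_T T X) S 0"
proof
  assume C3: "C3_at X (C_T T X) S 0"
  have X: "seminormed X" using assms(4) seminormed_Hs seminormed_real_Hs by auto
  have Y: "seminormed (C_T T X)" using X assms(3) by (intro seminormed_C_T) auto
  have S: "S a \<in> carrier (C_T T X)" if "a \<in> carrier X" for a
    using assms(5) that by (auto simp: solution_map_def)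
  \<comment> \<open>Since \<open>S\<close> maps into continuous functions with values in
    \<open>X\<close>, the classical solutions have mean zero at all times; no conservation law is
    invoked.\<close>
  have X0: "a 0 = 0" if "a \<in> carrier X" for a
    using assms(4) that by (auto simp: real_Hs_def Hs_def)
  from C3[unfolded C3_at_def diff_zero] obtain r0 D1 D2 D3 where r0: "0 < r0"
    and "\<forall>v\<in>carrier X. nrm X v < r0 \<longrightarrow>
      has_frechet_derivative X (C_T T X) S (D1 v) v \<and>
      has_frechet_derivative X (blin X (C_T T X)) D1 (D2 v) v \<and>
      has_frechet_derivative X (blin X (blin X (C_T T X))) D2 (D3 v) v"
    by (elim exE conjE) (rule that, assumption+)
  then have D: "\<And>v. v \<in> carrier X \<Longrightarrow> nrm X v < r0 \<Longrightarrow>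
      has_frechet_derivative X (C_T T X) S (D1 v) v \<and>
      has_frechet_derivative X (blin X (C_T T X)) D1 (D2 v) v \<and>
      has_frechet_derivative X (blin X (blin X (C_T T X))) D2 (D3 v) v"
    by blast
  define M where "M = nrm (blin X (blin X (blin X (C_T T X)))) (D3 0)"
  have "D3 0 \<in> carrier (blin X (blin X (blin X (C_T T X))))"
    using D[OF seminormedD(1)[OF X]] seminormedD(2)[OF X] r0 by (auto simp: has_frechet_derivative_def)
  then have M: "0 \<le> M" unfolding M_def by (rule blin_nrm_nonneg[OF _ X])
  have T: "T > 0" by fact
  define n where "n = 2 * j + 1"
  \<comment> \<open>\<open>c1\<close> collects the factors of the lower bound of
    \<open>6 * b\<close> that do not involve N. \<open>M'\<close> contains the cube of the norm of
    the mode without its weight, and \<open>e\<close> is negative exactly below the threshold for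
    s.\<close>
  define c1 where "c1 = 6 * pi * T / (8 * 2 ^ n)"
  define M' where "M' = M * (sqrt 2 * pi) ^ 3"
  define e where "e = 2 * s + 2 * real j - 1"
  have c1: "0 < c1" using T by (simp add: c1_def)
  have e: "e < 0" using assms(2) by (simp add: e_def)
  have bound: "c1 \<le> M' * real N powr e" if N: "1 \<le> N" "4 / T \<le> real N" for N :: nat
  proof -
    define m where "m = int N"
    have m: "1 \<le> m" using N by (simp add: m_def)
    define \<Psi> where "\<Psi> = (2 * m) ^ (2 * j + 1) - 2 * m ^ (2 * j + 1)"
    define \<beta> where "\<beta> = (\<i> * of_int m / (2 * of_real pi))\<^sup>2 / (\<i> * of_int \<Psi>)
      * - (of_real T - (chr (- \<Psi>) T - 1) / (\<i> * of_int \<Psi>))"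
    have \<Psi>: "m \<le> \<Psi>" "\<Psi> \<le> 2 ^ n * m ^ n"
      using resonance_function_bounds[OF m, of j] assms(1) by (auto simp: \<Psi>_def n_def)
    define b where "b = chr (- (m ^ (2 * j + 1))) T * (of_real pi ^ 3 * \<beta>)"
    define r where "r = 1 / (2 * pi * (8 + 16 * T))"
    define B where "B = bracket m"
    have B: "0 < B" "real N \<le> B"
      by (auto simp: B_def bracket_def m_def add_pos_nonneg real_le_rsqrt)
    have r: "0 < r" using T by (simp add: r_def)
    \<comment> \<open>Reading off the coefficient at m costs the weight \<open>B powr (- s)\<close>;
      the three arguments contribute \<open>B powr s\<close> each. The net power is
      \<open>2 * s\<close>.\<close>
    have "cmod (6 * b) \<le> B powr (- s) * M * (sqrt 2 * pi * B powr s) ^ 3"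
      unfolding M_def
    proof (rule cubic_coefficient_bound[OF X Y S r0 D, where P = "\<lambda>F. F T m" and \<phi> = "mode m" and b = b and r = r])
      show "linear (\<lambda>F :: real \<Rightarrow> int \<Rightarrow> complex. F T m)"
        using linear_compose[OF linear_fun_apply[of T] linear_fun_apply[of m]] by (simp add: o_def)
      show "cmod (F T m) \<le> B powr (- s) * nrm (C_T T X) F" if F: "F \<in> carrier (C_T T X)" for F
      proof -
        have TT: "T \<in> {0..T}" using T by simp
        have FT: "F T \<in> carrier X" using F TT by (auto simp: C_T_def)
        then have "F T \<in> carrier (Hs s)" "nrm (Hs s) (F T) = nrm X (F T)"
          using assms(4) by (auto simp: real_Hs_def)
        then have "B powr s * cmod (F T m) \<le> nrm X (F T)"
          using Hs_coeff_bound[of "F T" s m] m by (simp add: B_def)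
        also have "\<dots> \<le> nrm (C_T T X) F" by (rule C_T_nrm_bound[OF X F TT])
        finally show ?thesis using B by (simp add: powr_minus field_simps)
      qed
      show "c *\<^sub>R mode m \<in> carrier X" "nrm X (c *\<^sub>R mode m) = \<bar>c\<bar> * (sqrt 2 * pi * B powr s)" for c
        unfolding B_def by (rule mode_Hs[OF m assms(4)])+
      fix x :: real assume x: "x \<noteq> 0" "\<bar>x\<bar> < r"
      define f where "f = trig m (of_real (x / 2)) (of_real (x / 2))"
      have f: "fourier f = x *\<^sub>R mode m" unfolding f_def using m by (intro fourier_trig) auto
      have fX: "fourier f \<in> carrier X" unfolding f by (rule mode_Hs(1)[OF m assms(4)])
      then obtain u where u: "classical_solution j T f u" "\<And>t. t \<in> {0..T} \<Longrightarrow> S (fourier f) t = fourier (u t)"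
        using assms(5) smooth_periodic_trig unfolding solution_map_def f_def by blast
      have zero: "fourier (u t) 0 = 0" if t: "t \<in> {0..T}" for t
      proof -
        have "S (fourier f) t \<in> carrier X" using S[OF fX] t by (auto simp: C_T_def)
        then show ?thesis using X0 u(2)[OF t] by metis
      qed
      have "2 * pi * \<bar>x\<bar> * (8 + 16 * T) < 1"
        using x(2) T by (simp add: r_def pos_less_divide_eq mult_ac)
      from solution_cubic_expansion[OF u(1) f m _ less_imp_le[OF T] zero x(1) this]
      show "cmod (S (x *\<^sub>R mode m) T m - (of_real x * (chr (- (m ^ (2 * j + 1))) T * of_real pi) + of_real (x ^ 3) * b))
        \<le> T * (real_of_int m * ((2 + 2 * T)\<^sup>2 + 8 * real_of_int m * T * (2 + 2 * T))) * (4 * pi) ^ 4 * x ^ 4"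
        using assms(1) m \<Psi>(1) T u(2)[of T] unfolding b_def \<beta>_def \<Psi>_def f by simp
    qed (use r B in auto)
    also have "\<dots> = M' * B powr (2 * s)"
    proof -
      have "B powr (- s) * (B powr s) ^ 3 = B powr (2 * s)"
        using B by (simp add: power3_eq_cube flip: powr_add)
      then show ?thesis by (simp add: M'_def power_mult_distrib mult_ac)
    qed
    \<comment> \<open>The bracket exceeds N, and s is negative, so replacing it by N increases the
      bound.\<close>
    also have "\<dots> \<le> M' * real N powr (2 * s)"
      using M B N assms(1,2) by (intro mult_left_mono powr_mono2') (auto simp: M'_def)
    finally have up: "cmod (6 * b) \<le> M' * real N powr (2 * s)" .
    have "4 / T \<le> real_of_int \<Psi>" using N(2) \<Psi>(1) by (simp add: m_def) 
    then have "(real N)\<^sup>2 * T / (8 * pi\<^sup>2 * real_of_int \<Psi>) \<le> cmod \<beta>"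
      using resonant_coefficient_lower_bound[OF T, of \<Psi> m] by (simp add: \<beta>_def m_def)
    moreover have "(real N)\<^sup>2 * T / (8 * pi\<^sup>2 * (2 ^ n * real N ^ n)) \<le> (real N)\<^sup>2 * T / (8 * pi\<^sup>2 * real_of_int \<Psi>)"
    proof (intro divide_left_mono mult_left_mono)
      have "real_of_int \<Psi> \<le> real_of_int (2 ^ n * m ^ n)" using \<Psi>(2) by (simp only: of_int_le_iff)
      then show "real_of_int \<Psi> \<le> 2 ^ n * real N ^ n" by (simp add: m_def)
    qed (use T m \<Psi>(1) N in auto)
    ultimately have "(real N)\<^sup>2 * T / (8 * pi\<^sup>2 * (2 ^ n * real N ^ n)) \<le> cmod \<beta>" by linarith
    then have "6 * pi ^ 3 * ((real N)\<^sup>2 * T / (8 * pi\<^sup>2 * (2 ^ n * real N ^ n))) \<le> 6 * pi ^ 3 * cmod \<beta>"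
      by (intro mult_left_mono) auto
    also have "\<dots> = cmod (6 * b)"
      by (simp add: b_def norm_mult norm_power)
    also note up
    finally have "c1 * ((real N)\<^sup>2 / real N ^ n) \<le> M' * real N powr (2 * s)"
      by (simp add: c1_def power2_eq_square power3_eq_cube mult_ac)
    moreover have "(real N)\<^sup>2 / real N ^ n = real N powr (1 - 2 * real j)"
      using N by (simp add: n_def powr_diff powr_realpow power2_eq_square flip: powr_realpow) 
    ultimately have "c1 * real N powr (1 - 2 * real j) \<le> M' * real N powr (2 * s)" by simp
    then have "(c1 * real N powr (1 - 2 * real j)) * real N powr (2 * real j - 1) \<le> (M' * real N powr (2 * s)) * real N powr (2 * real j - 1)"
      by (intro mult_right_mono) auto
    then show ?thesis using N by (simp add: mult.assoc e_def add_diff_eq flip: powr_add)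
  qed
  have "(\<lambda>N::nat. M' * real N powr e) \<longlonglongrightarrow> M' * 0"
    using e by (intro tendsto_mult tendsto_const tendsto_neg_powr filterlim_real_sequentially)
  then have "\<forall>\<^sub>F N in sequentially. M' * real N powr e < c1"
    using c1 by (intro order_tendstoD(2)) auto
  then obtain N0 where N0: "\<And>N. N \<ge> N0 \<Longrightarrow> M' * real N powr e < c1"
    by (auto simp: eventually_sequentially)
  \<comment> \<open>The entry \<open>4 / T\<close> ensures that the resonance function, which is at
    least N, dominates the oscillating part.\<close>
  define N where "N = max N0 (max 1 (nat \<lceil>4 / T\<rceil>))"
  have "4 / T \<le> real N" unfolding N_def by linarith
  moreover have "1 \<le> N" "N0 \<le> N" by (simp_all add: N_def)
  ultimately show False using bound[of N] N0[of N] by linarith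
qed

end
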